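(* Let $((A,[,]),N)$ be a Nijenhuis left Alia algebra over $K$, $(V,\ell,\rho)$ a representation of $(A,[,])$ with $V$ finite-dimensional, $\beta:V\to V$ a linear map that is admissible to $((A,[,]),N)$ with respect to $(V,\ell,\rho)$, and let $S:A\to A$, $\alpha:V\to V$, $T:V\to A$ be linear maps. Let $T_\sharp\in V^*\otimes A\subset(A\oplus V^* )\otimes(A\oplus V^* )$ be given by $\langle T_\sharp,u\otimes a^*\rangle=\langle T(u),a^*\rangle$ for $u\in V$, $a^*\in A^*$, and put $r=T_\sharp-\tau(T_\sharp)$. (1) $r$ is an antisymmetric solution of the $(S+\alpha^* )$-admissible left Alia Yang-Baxter equation in the Nijenhuis left Alia algebra $(A\ltimes_{\ell^*,\ell^*-\rho^*}V^*,N+\beta^* )$ if and only if $T$ is a weak relative Rota-Baxter operator of $((A,[,]),N)$ associated to $(V,\ell,\rho)$ and $\alpha$, and $T\circ\beta=S\circ T$. (2) Assume that $((V,\ell,\rho),\alpha)$ is a representation of $((A,[,]),N)$. If $T$ is a relative Rota-Baxter operator of $((A,[,]),N)$ associated to $((V,\ell,\rho),\alpha)$ and $T\circ\beta=S\circ T$, then $r$ is an antisymmetric solution of the $(S+\alpha^* )$-admissible left Alia Yang-Baxter equation in $(A\ltimes_{\ell^*,\ell^*-\rho^*}V^*,N+\beta^* )$. In addition, if $((A,[,]),N)$ is $S$-adjoint-admissible and for all $x\in A$, $v\in V$ $$\beta(\rho(x)(\alpha(v)))+\rho(S^2(x))(v)=\rho(S(x))(\alpha(v))+\beta(\rho(S(x))(v)),$$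 $$\beta(\ell(x)(\alpha(v)))+\ell(S^2(x))(v)=\ell(S(x))(\alpha(v))+\beta(\ell(S(x))(v)),$$ then $((A\ltimes_{\ell^*,\ell^*-\rho^*}V^*,\Delta),N+\beta^*,S+\alpha^* )$ is a Nijenhuis left Alia bialgebra, where $\Delta=\Delta_r$ with $r=T_\sharp-\tau(T_\sharp)$.
   Context: $K$ is a field of characteristic zero; $\tau$ is the flip map; $r$ is antisymmetric if $r+\tau(r)=0$. A left Alia algebra is $(A,[,])$ with $[,]$ bilinear and $[[x,y],z]+[[y,z],x]+[[z,x],y]=[[y,x],z]+[[z,y],x]+[[x,z],y]$. A Nijenhuis left Alia algebra $((A,[,]),N)$ has in addition a linear map $N$ with $[N(x),N(y)]+N^2([x,y])=N([N(x),y]+[x,N(y)])$. It is $S$-adjoint-admissible ($S$ is adjoint-admissible to it) if $S[N(x),y]+[x,S^2(y)]=S[x,S(y)]+[N(x),S(y)]$ and $S[x,N(y)]+[S^2(x),y]=S[S(x),y]+[S(x),N(y)]$ for all $x,y$. A representation of $(A,[,])$ is $(V,\ell,\rho)$ with $\ell,\rho:A\to\mathrm{End}(V)$ linear and $\ell([x,y])-\ell([y,x])=\rho(x)(\rho(y)-\ell(y))-\rho(y)(\rho(x)-\ell(x))$. $((V,\ell,\rho),\alpha)$ is a representation of $((A,[,]),N)$ if moreover $\ell(N(x))(\alpha(v))+\alpha^2(\ell(x)(v))=\alpha(\ell(N(x))(v))+\alpha(\ell(x)(\alpha(v)))$ and the same with $\rho$ in place of $\ell$. $\beta$ is admissible to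 $((A,[,]),N)$ with respect to $(V,\ell,\rho)$ if $\beta(\ell(N(x))(v))+\ell(x)(\beta^2(v))=\ell(N(x))(\beta(v))+\beta(\ell(x)(\beta(v)))$ and the same with $\rho$ in place of $\ell$. For $\sigma:A\to\mathrm{End}(V)$, $\sigma^*:A\to\mathrm{End}(V^* )$ is $\langle\sigma^*(x)u^*,v\rangle=-\langle u^*,\sigma(x)v\rangle$; for linear $\alpha:V\to V$, $\alpha^*:V^*\to V^*$ is the usual transpose (no sign). If $(V,\ell,\rho)$ is a representation then so is $(V^*,\ell^*,\ell^*-\rho^* )$. The semi-direct product $A\ltimes_{\ell',\rho'}W$ is $A\oplus W$ with $[x+u,y+v]=[x,y]+\ell'(x)v+\rho'(y)u$; $(N+\beta^* )(x+u^* )=N(x)+\beta^*(u^* )$, similarly $S+\alpha^*$. For a left Alia algebra $B$ with linear maps $M,P:B\to B$ ($M$ a Nijenhuis operator), the $P$-admissible left Alia Yang-Baxter equation in $(B,M)$ for $r=\sum_i a_i\otimes b_i\in B\otimes B$ is the pair of equations $$\sum_{i,j}\big([a_i,a_j]\otimes b_i\otimes b_j+a_i\otimes([a_j,b_i]-[b_i,a_j])\otimes b_j-a_i\otimes a_j\otimes[b_j,b_i]\big)=0,\qquad(P\otimes\mathrm{id}-\mathrm{id}\otimes M)(r)=0,$$ and $\Delta_r(x)=\sum_i\big(([a_i,x]-[x,a_i])\otimes b_i-a_i\otimes[b_i,x]\big)$ for $x\in B$. A linear map $T:V\to A$ is a weak relative Rota-Baxter operator of $((A,[,]),N)$ associated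 to $(V,\ell,\rho)$ and $\alpha$ if $[T(u),T(v)]=T(\ell(T(u))(v)+\rho(T(v))(u))$ for all $u,v\in V$ and $N\circ T=T\circ\alpha$. If $((V,\ell,\rho),\alpha)$ is a representation of $((A,[,]),N)$, such a $T$ is called a relative Rota-Baxter operator of $((A,[,]),N)$ associated to $((V,\ell,\rho),\alpha)$. Write $\Delta(x)=x_{(1)}\otimes x_{(2)}$. A left Alia coalgebra is $(B,\Delta)$ with $$x_{(1)(2)}\otimes x_{(1)(1)}\otimes x_{(2)}+x_{(1)(1)}\otimes x_{(2)}\otimes x_{(1)(2)}+x_{(2)}\otimes x_{(1)(2)}\otimes x_{(1)(1)}=x_{(1)(1)}\otimes x_{(1)(2)}\otimes x_{(2)}+x_{(1)(2)}\otimes x_{(2)}\otimes x_{(1)(1)}+x_{(2)}\otimes x_{(1)(1)}\otimes x_{(1)(2)},$$ where $x_{(1)(1)}\otimes x_{(1)(2)}\otimes x_{(2)}=(\Delta\otimes\mathrm{id})\Delta(x)$. A left Alia bialgebra is $(B,[,],\Delta)$ with $(B,[,])$ a left Alia algebra, $(B,\Delta)$ a left Alia coalgebra and $(\tau-\mathrm{id}^{\otimes 2})(\Delta([x,y]-[y,x]))=(\tau-\mathrm{id}^{\otimes 2})((\mathcal R(y)\otimes\mathrm{id})\Delta(x)-(\mathcal R(x)\otimes\mathrm{id})\Delta(y))$, where $\mathcal R(y)z=[z,y]$. A Nijenhuis left Alia bialgebra $((B,[,],\Delta),M,P)$ is a left Alia bialgebra such that $((B,[,]),M)$ is a $P$-adjoint-admissible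 Nijenhuis left Alia algebra and for all $x\in B$: $P(x_{(1)})\otimes P(x_{(2)})+P^2(x)_{(1)}\otimes P^2(x)_{(2)}=P(P(x)_{(1)})\otimes P(x)_{(2)}+P(x)_{(1)}\otimes P(P(x)_{(2)})$; $P(M(x)_{(1)})\otimes M(x)_{(2)}+x_{(1)}\otimes M^2(x_{(2)})=P(x_{(1)})\otimes M(x_{(2)})+M(x)_{(1)}\otimes M(M(x)_{(2)})$; $M(x)_{(1)}\otimes P(M(x)_{(2)})+M^2(x_{(1)})\otimes x_{(2)}=M(x_{(1)})\otimes P(x_{(2)})+M(M(x)_{(1)})\otimes M(x)_{(2)}$. *)

theory Defs
  imports Complex_Main "HOL-Library.Poly_Mapping" "HOL-Library.Product_Plus"
    "HOL-Library.Function_Algebras"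
begin

text \<open>
  Vector spaces over a field \<open>'k\<close> of characteristic zero are given by a scalar multiplication
  \<open>scale\<close> as in \<^locale>\<open>vector_space\<close>. The dual space is not a type but a subspace of \<open>'v \<Rightarrow> 'k\<close>,
  so algebras are defined on a subspace \<open>B\<close> of the ambient type, and operations on them only
  matter on \<open>B\<close>.
\<close>

definition linear_on ::
  "('k::field \<Rightarrow> 'b::ab_group_add \<Rightarrow> 'b) \<Rightarrow> 'b set \<Rightarrow> ('b \<Rightarrow> 'b) \<Rightarrow> bool" where
  "linear_on scale B f \<longleftrightarrow>
     (\<forall>x\<in>B. f x \<in> B) \<and>
     (\<forall>x\<in>B. \<forall>y\<in>B. f (x + y) = f x + f y) \<and>
     (\<forall>c. \<forall>x\<in>B. f (scale c x) = scale c (f x))"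

text \<open>
  The tensor product \<open>B \<otimes> C\<close> is the vector space of formal linear combinations of pairs in
  \<open>B \<times> C\<close>, modulo the span of the multilinearity relators; likewise for \<open>B \<otimes> B \<otimes> B\<close>.
  A tensor is represented by a formal combination, and equality of tensors is
  congruence of representatives modulo that span.
\<close>

definition fscale :: "'k::field \<Rightarrow> ('p \<Rightarrow>\<^sub>0 'k) \<Rightarrow> 'p \<Rightarrow>\<^sub>0 'k" where
  "fscale c t = Poly_Mapping.map ((*) c) t"

lemma lookup_fscale [simp]:
  "Poly_Mapping.lookup (fscale c t) p = c * Poly_Mapping.lookup t p"
  by (simp add: fscale_def Poly_Mapping.map.rep_eq when_def)

interpretation formal: vector_space "fscale :: 'k::field \<Rightarrow> ('p \<Rightarrow>\<^sub>0 'k) \<Rightarrow> 'p \<Rightarrow>\<^sub>0 'k"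
  by unfold_locales (auto intro!: poly_mapping_eqI simp: lookup_add algebra_simps)

definition ten2 :: "'b \<Rightarrow> 'c \<Rightarrow> ('b \<times> 'c) \<Rightarrow>\<^sub>0 'k::field" where
  "ten2 x y = Poly_Mapping.single (x, y) 1"

definition ten3 :: "'b \<Rightarrow> 'c \<Rightarrow> 'd \<Rightarrow> ('b \<times> 'c \<times> 'd) \<Rightarrow>\<^sub>0 'k::field" where
  "ten3 x y z = Poly_Mapping.single (x, y, z) 1"

text \<open>The linear extension of a map on generators: \<open>\<Sum> c\<^sub>p p\<close> is sent to \<open>\<Sum> c\<^sub>p F p\<close>.\<close>
definition lext :: "('p \<Rightarrow>\<^sub>0 'k::field) \<Rightarrow> ('p \<Rightarrow> 'q \<Rightarrow>\<^sub>0 'k) \<Rightarrow> 'q \<Rightarrow>\<^sub>0 'k" where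
  "lext t F = (\<Sum>p\<in>Poly_Mapping.keys t. fscale (Poly_Mapping.lookup t p) (F p))"

text \<open>A slot is a map sending \<open>x\<close> to an elementary tensor with \<open>x\<close> in one place and the
  other places fixed.\<close>
definition multilinear_relators ::
  "('k::field \<Rightarrow> 'b::ab_group_add \<Rightarrow> 'b) \<Rightarrow> 'b set \<Rightarrow> ('b \<Rightarrow> 'p \<Rightarrow>\<^sub>0 'k) set \<Rightarrow> ('p \<Rightarrow>\<^sub>0 'k) set" where
  "multilinear_relators scale B slots =
     {\<phi> (x + y) - \<phi> x - \<phi> y | \<phi> x y. \<phi> \<in> slots \<and> x \<in> B \<and> y \<in> B} \<union>
     {\<phi> (scale c x) - fscale c (\<phi> x) | \<phi> c x. \<phi> \<in> slots \<and> x \<in> B}"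

definition slots2 :: "'b set \<Rightarrow> ('b \<Rightarrow> ('b \<times> 'b) \<Rightarrow>\<^sub>0 'k::field) set" where
  "slots2 B = {(\<lambda>x. ten2 x y) | y. y \<in> B} \<union> {(\<lambda>y. ten2 x y) | x. x \<in> B}"

definition slots3 :: "'b set \<Rightarrow> ('b \<Rightarrow> ('b \<times> 'b \<times> 'b) \<Rightarrow>\<^sub>0 'k::field) set" where
  "slots3 B = {(\<lambda>x. ten3 x y z) | y z. y \<in> B \<and> z \<in> B} \<union>
              {(\<lambda>y. ten3 x y z) | x z. x \<in> B \<and> z \<in> B} \<union>
              {(\<lambda>z. ten3 x y z) | x y. x \<in> B \<and> y \<in> B}"

definition tensors2 :: "'b set \<Rightarrow> 'c set \<Rightarrow> (('b \<times> 'c) \<Rightarrow>\<^sub>0 'k::field) set" where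
  "tensors2 B C = {t. Poly_Mapping.keys t \<subseteq> B \<times> C}"

definition eq_tensor2 :: "('k::field \<Rightarrow> 'b::ab_group_add \<Rightarrow> 'b) \<Rightarrow> 'b set \<Rightarrow>
    (('b \<times> 'b) \<Rightarrow>\<^sub>0 'k) \<Rightarrow> (('b \<times> 'b) \<Rightarrow>\<^sub>0 'k) \<Rightarrow> bool" where
  "eq_tensor2 scale B s t \<longleftrightarrow>
     s - t \<in> formal.span (multilinear_relators scale B (slots2 B))"

definition eq_tensor3 :: "('k::field \<Rightarrow> 'b::ab_group_add \<Rightarrow> 'b) \<Rightarrow> 'b set \<Rightarrow>
    (('b \<times> 'b \<times> 'b) \<Rightarrow>\<^sub>0 'k) \<Rightarrow> (('b \<times> 'b \<times> 'b) \<Rightarrow>\<^sub>0 'k) \<Rightarrow> bool" where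
  "eq_tensor3 scale B s t \<longleftrightarrow>
     s - t \<in> formal.span (multilinear_relators scale B (slots3 B))"

definition map_tensor :: "('b \<Rightarrow> 'c) \<Rightarrow> ('d \<Rightarrow> 'e) \<Rightarrow> (('b \<times> 'd) \<Rightarrow>\<^sub>0 'k::field) \<Rightarrow> ('c \<times> 'e) \<Rightarrow>\<^sub>0 'k" where
  "map_tensor f g t = lext t (\<lambda>(x, y). ten2 (f x) (g y))"

definition flip_tensor :: "(('b \<times> 'c) \<Rightarrow>\<^sub>0 'k::field) \<Rightarrow> ('c \<times> 'b) \<Rightarrow>\<^sub>0 'k" where
  "flip_tensor t = lext t (\<lambda>(x, y). ten2 y x)"

locale left_alia_algebra = vector_space scale
  for scale :: "'k::field_char_0 \<Rightarrow> 'b::ab_group_add \<Rightarrow> 'b" +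
  fixes B :: "'b set" and br :: "'b \<Rightarrow> 'b \<Rightarrow> 'b"
  assumes subspace: "subspace B"
    and closed: "\<lbrakk>x \<in> B; y \<in> B\<rbrakk> \<Longrightarrow> br x y \<in> B"
    and add_left: "\<lbrakk>x \<in> B; y \<in> B; z \<in> B\<rbrakk> \<Longrightarrow> br (x + y) z = br x z + br y z"
    and add_right: "\<lbrakk>x \<in> B; y \<in> B; z \<in> B\<rbrakk> \<Longrightarrow> br x (y + z) = br x y + br x z"
    and scale_left: "\<lbrakk>x \<in> B; y \<in> B\<rbrakk> \<Longrightarrow> br (scale c x) y = scale c (br x y)"
    and scale_right: "\<lbrakk>x \<in> B; y \<in> B\<rbrakk> \<Longrightarrow> br x (scale c y) = scale c (br x y)"
    and alia: "\<lbrakk>x \<in> B; y \<in> B; z \<in> B\<rbrakk> \<Longrightarrow>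
      br (br x y) z + br (br y z) x + br (br z x) y =
      br (br y x) z + br (br z y) x + br (br x z) y"

locale nijenhuis_left_alia_algebra = left_alia_algebra scale B br
  for scale :: "'k::field_char_0 \<Rightarrow> 'b::ab_group_add \<Rightarrow> 'b" and B br +
  fixes N :: "'b \<Rightarrow> 'b"
  assumes linear_N: "linear_on scale B N"
    and nijenhuis: "\<lbrakk>x \<in> B; y \<in> B\<rbrakk> \<Longrightarrow>
      br (N x) (N y) + N (N (br x y)) = N (br (N x) y + br x (N y))"

definition adjoint_admissible ::
  "'b::ab_group_add set \<Rightarrow> ('b \<Rightarrow> 'b \<Rightarrow> 'b) \<Rightarrow> ('b \<Rightarrow> 'b) \<Rightarrow> ('b \<Rightarrow> 'b) \<Rightarrow> bool" where
  "adjoint_admissible B br N S \<longleftrightarrow>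
     (\<forall>x\<in>B. \<forall>y\<in>B.
        S (br (N x) y) + br x (S (S y)) = S (br x (S y)) + br (N x) (S y) \<and>
        S (br x (N y)) + br (S (S x)) y = S (br (S x) y) + br (S x) (N y))"

locale left_alia_representation =
  algebra: left_alia_algebra scaleA UNIV br + module: vector_space scaleV
  for scaleA :: "'k::field_char_0 \<Rightarrow> 'a::ab_group_add \<Rightarrow> 'a" and br
    and scaleV :: "'k \<Rightarrow> 'v::ab_group_add \<Rightarrow> 'v" +
  fixes l \<rho> :: "'a \<Rightarrow> 'v \<Rightarrow> 'v"
  assumes linear_l: "Vector_Spaces.linear scaleV scaleV (l x)"
    and linear_\<rho>: "Vector_Spaces.linear scaleV scaleV (\<rho> x)"
    and l_add: "l (x + y) v = l x v + l y v"
    and l_scale: "l (scaleA c x) v = scaleV c (l x v)"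
    and \<rho>_add: "\<rho> (x + y) v = \<rho> x v + \<rho> y v"
    and \<rho>_scale: "\<rho> (scaleA c x) v = scaleV c (\<rho> x v)"
    and representation: "l (br x y) v - l (br y x) v =
      \<rho> x (\<rho> y v - l y v) - \<rho> y (\<rho> x v - l x v)"

locale nijenhuis_left_alia_representation =
  nijenhuis_left_alia_algebra scaleA UNIV br N + left_alia_representation scaleA br scaleV l \<rho>
  for scaleA :: "'k::field_char_0 \<Rightarrow> 'a::ab_group_add \<Rightarrow> 'a" and br N
    and scaleV :: "'k \<Rightarrow> 'v::ab_group_add \<Rightarrow> 'v" and l \<rho> +
  fixes \<alpha> :: "'v \<Rightarrow> 'v"
  assumes linear_\<alpha>: "Vector_Spaces.linear scaleV scaleV \<alpha>"
    and l_\<alpha>: "l (N x) (\<alpha> v) + \<alpha> (\<alpha> (l x v)) = \<alpha> (l (N x) v) + \<alpha> (l x (\<alpha> v))"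
    and \<rho>_\<alpha>: "\<rho> (N x) (\<alpha> v) + \<alpha> (\<alpha> (\<rho> x v)) = \<alpha> (\<rho> (N x) v) + \<alpha> (\<rho> x (\<alpha> v))"

definition admissible_operator ::
  "('a \<Rightarrow> 'a) \<Rightarrow> ('a \<Rightarrow> 'v::ab_group_add \<Rightarrow> 'v) \<Rightarrow> ('a \<Rightarrow> 'v \<Rightarrow> 'v) \<Rightarrow> ('v \<Rightarrow> 'v) \<Rightarrow> bool" where
  "admissible_operator N l \<rho> \<beta> \<longleftrightarrow>
     (\<forall>x v. \<beta> (l (N x) v) + l x (\<beta> (\<beta> v)) = l (N x) (\<beta> v) + \<beta> (l x (\<beta> v)) \<and>
            \<beta> (\<rho> (N x) v) + \<rho> x (\<beta> (\<beta> v)) = \<rho> (N x) (\<beta> v) + \<beta> (\<rho> x (\<beta> v)))"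

definition weak_relative_rota_baxter ::
  "('k::field_char_0 \<Rightarrow> 'a::ab_group_add \<Rightarrow> 'a) \<Rightarrow> ('a \<Rightarrow> 'a \<Rightarrow> 'a) \<Rightarrow> ('a \<Rightarrow> 'a) \<Rightarrow>
   ('k \<Rightarrow> 'v::ab_group_add \<Rightarrow> 'v) \<Rightarrow> ('a \<Rightarrow> 'v \<Rightarrow> 'v) \<Rightarrow> ('a \<Rightarrow> 'v \<Rightarrow> 'v) \<Rightarrow> ('v \<Rightarrow> 'v) \<Rightarrow>
   ('v \<Rightarrow> 'a) \<Rightarrow> bool" where
  "weak_relative_rota_baxter scaleA br N scaleV l \<rho> \<alpha> T \<longleftrightarrow>
     Vector_Spaces.linear scaleV scaleA T \<and>
     (\<forall>u v. br (T u) (T v) = T (l (T u) v + \<rho> (T v) u)) \<and>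
     N \<circ> T = T \<circ> \<alpha>"

definition relative_rota_baxter ::
  "('k::field_char_0 \<Rightarrow> 'a::ab_group_add \<Rightarrow> 'a) \<Rightarrow> ('a \<Rightarrow> 'a \<Rightarrow> 'a) \<Rightarrow> ('a \<Rightarrow> 'a) \<Rightarrow>
   ('k \<Rightarrow> 'v::ab_group_add \<Rightarrow> 'v) \<Rightarrow> ('a \<Rightarrow> 'v \<Rightarrow> 'v) \<Rightarrow> ('a \<Rightarrow> 'v \<Rightarrow> 'v) \<Rightarrow> ('v \<Rightarrow> 'v) \<Rightarrow>
   ('v \<Rightarrow> 'a) \<Rightarrow> bool" where
  "relative_rota_baxter scaleA br N scaleV l \<rho> \<alpha> T \<longleftrightarrow>
     nijenhuis_left_alia_representation scaleA br N scaleV l \<rho> \<alpha> \<and>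
     weak_relative_rota_baxter scaleA br N scaleV l \<rho> \<alpha> T"

definition dual_space :: "('k::field \<Rightarrow> 'v::ab_group_add \<Rightarrow> 'v) \<Rightarrow> ('v \<Rightarrow> 'k) set" where
  "dual_space scaleV = {f. Vector_Spaces.linear scaleV (*) f}"

text \<open>The dual of an action carries a sign, the dual (transpose) of a single operator does not.\<close>
definition dual_action :: "('a \<Rightarrow> 'v \<Rightarrow> 'v) \<Rightarrow> 'a \<Rightarrow> ('v \<Rightarrow> 'k::field) \<Rightarrow> 'v \<Rightarrow> 'k" where
  "dual_action \<sigma> x f = (\<lambda>v. - f (\<sigma> x v))"

definition dual_map :: "('v \<Rightarrow> 'v) \<Rightarrow> ('v \<Rightarrow> 'k::field) \<Rightarrow> 'v \<Rightarrow> 'k" where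
  "dual_map \<alpha> f = f \<circ> \<alpha>"

definition semidirect_bracket ::
  "('a \<Rightarrow> 'a \<Rightarrow> 'a) \<Rightarrow> ('a \<Rightarrow> 'w::ab_group_add \<Rightarrow> 'w) \<Rightarrow> ('a \<Rightarrow> 'w \<Rightarrow> 'w) \<Rightarrow>
   'a \<times> 'w \<Rightarrow> 'a \<times> 'w \<Rightarrow> 'a \<times> 'w" where
  "semidirect_bracket br l' \<rho>' = (\<lambda>(x, u) (y, v). (br x y, l' x v + \<rho>' y u))"

definition dual_sum_scale ::
  "('k::field \<Rightarrow> 'a \<Rightarrow> 'a) \<Rightarrow> 'k \<Rightarrow> 'a \<times> ('v \<Rightarrow> 'k) \<Rightarrow> 'a \<times> ('v \<Rightarrow> 'k)" where
  "dual_sum_scale scaleA c = (\<lambda>(x, f). (scaleA c x, \<lambda>v. c * f v))"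

text \<open>The value of a tensor in \<open>V\<^sup>* \<otimes> A\<close> on \<open>u \<otimes> a\<^sup>*\<close>.\<close>
definition tensor_pairing :: "(('v \<Rightarrow> 'k) \<times> 'a \<Rightarrow>\<^sub>0 'k::field) \<Rightarrow> 'v \<Rightarrow> ('a \<Rightarrow> 'k) \<Rightarrow> 'k" where
  "tensor_pairing t u g =
     (\<Sum>p\<in>Poly_Mapping.keys t. Poly_Mapping.lookup t p * (fst p u * g (snd p)))"

definition represents_map ::
  "('k::field \<Rightarrow> 'a::ab_group_add \<Rightarrow> 'a) \<Rightarrow> ('k \<Rightarrow> 'v::ab_group_add \<Rightarrow> 'v) \<Rightarrow> ('v \<Rightarrow> 'a) \<Rightarrow>
   (('v \<Rightarrow> 'k) \<times> 'a \<Rightarrow>\<^sub>0 'k) \<Rightarrow> bool" where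
  "represents_map scaleA scaleV T t \<longleftrightarrow>
     t \<in> tensors2 (dual_space scaleV) UNIV \<and>
     (\<forall>u. \<forall>g \<in> dual_space scaleA. tensor_pairing t u g = g (T u))"

text \<open>The inclusion of \<open>V\<^sup>* \<otimes> A\<close> into \<open>(A \<oplus> V\<^sup>*) \<otimes> (A \<oplus> V\<^sup>*)\<close>.\<close>
definition include_tensor ::
  "(('w::zero) \<times> ('a::zero) \<Rightarrow>\<^sub>0 'k::field) \<Rightarrow> (('a \<times> 'w) \<times> ('a \<times> 'w)) \<Rightarrow>\<^sub>0 'k" where
  "include_tensor t = map_tensor (\<lambda>f. (0, f)) (\<lambda>a. (a, 0)) t"

definition antisymmetric_tensor ::
  "('k::field \<Rightarrow> 'b::ab_group_add \<Rightarrow> 'b) \<Rightarrow> 'b set \<Rightarrow> ('b \<times> 'b \<Rightarrow>\<^sub>0 'k) \<Rightarrow> bool" where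
  "antisymmetric_tensor scale B r \<longleftrightarrow> eq_tensor2 scale B (r + flip_tensor r) 0"

definition yang_baxter_tensor ::
  "('b::ab_group_add \<Rightarrow> 'b \<Rightarrow> 'b) \<Rightarrow> ('b \<times> 'b \<Rightarrow>\<^sub>0 'k::field) \<Rightarrow> 'b \<times> 'b \<times> 'b \<Rightarrow>\<^sub>0 'k" where
  "yang_baxter_tensor br r =
     lext r (\<lambda>(a, b). lext r (\<lambda>(a', b').
       ten3 (br a a') b b' + ten3 a (br a' b - br b a') b' - ten3 a a' (br b' b)))"

definition admissible_yang_baxter_solution ::
  "('k::field \<Rightarrow> 'b::ab_group_add \<Rightarrow> 'b) \<Rightarrow> 'b set \<Rightarrow> ('b \<Rightarrow> 'b \<Rightarrow> 'b) \<Rightarrow>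
   ('b \<Rightarrow> 'b) \<Rightarrow> ('b \<Rightarrow> 'b) \<Rightarrow> ('b \<times> 'b \<Rightarrow>\<^sub>0 'k) \<Rightarrow> bool" where
  "admissible_yang_baxter_solution scale B br M P r \<longleftrightarrow>
     r \<in> tensors2 B B \<and>
     eq_tensor3 scale B (yang_baxter_tensor br r) 0 \<and>
     eq_tensor2 scale B (map_tensor P id r - map_tensor id M r) 0"

definition coboundary ::
  "('b::ab_group_add \<Rightarrow> 'b \<Rightarrow> 'b) \<Rightarrow> ('b \<times> 'b \<Rightarrow>\<^sub>0 'k::field) \<Rightarrow> 'b \<Rightarrow> 'b \<times> 'b \<Rightarrow>\<^sub>0 'k" where
  "coboundary br r x = lext r (\<lambda>(a, b). ten2 (br a x - br x a) b - ten2 a (br b x))"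

text \<open>For \<open>(\<Delta> \<otimes> id) \<Delta>(x) = \<Sum> p \<otimes> q \<otimes> s\<close> in Sweedler notation (so \<open>p = x\<^sub>(\<^sub>1\<^sub>)\<^sub>(\<^sub>1\<^sub>)\<close>,
  \<open>q = x\<^sub>(\<^sub>1\<^sub>)\<^sub>(\<^sub>2\<^sub>)\<close>, \<open>s = x\<^sub>(\<^sub>2\<^sub>)\<close>), this is \<open>\<Sum> F p q s\<close>.\<close>
definition iterated_coproduct ::
  "('b \<Rightarrow> 'b \<times> 'b \<Rightarrow>\<^sub>0 'k::field) \<Rightarrow> 'b \<Rightarrow> ('b \<Rightarrow> 'b \<Rightarrow> 'b \<Rightarrow> 'q \<Rightarrow>\<^sub>0 'k) \<Rightarrow> 'q \<Rightarrow>\<^sub>0 'k" where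
  "iterated_coproduct \<Delta> x F = lext (\<Delta> x) (\<lambda>(y, s). lext (\<Delta> y) (\<lambda>(p, q). F p q s))"

locale left_alia_coalgebra = vector_space scale
  for scale :: "'k::field_char_0 \<Rightarrow> 'b::ab_group_add \<Rightarrow> 'b" +
  fixes B :: "'b set" and \<Delta> :: "'b \<Rightarrow> 'b \<times> 'b \<Rightarrow>\<^sub>0 'k"
  assumes coalgebra_subspace: "subspace B"
    and \<Delta>_closed: "x \<in> B \<Longrightarrow> \<Delta> x \<in> tensors2 B B"
    and \<Delta>_add: "\<lbrakk>x \<in> B; y \<in> B\<rbrakk> \<Longrightarrow> eq_tensor2 scale B (\<Delta> (x + y)) (\<Delta> x + \<Delta> y)"
    and \<Delta>_scale: "x \<in> B \<Longrightarrow> eq_tensor2 scale B (\<Delta> (scale c x)) (fscale c (\<Delta> x))"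
    and coalia: "x \<in> B \<Longrightarrow> eq_tensor3 scale B
      (iterated_coproduct \<Delta> x (\<lambda>p q s. ten3 q p s + ten3 p s q + ten3 s q p))
      (iterated_coproduct \<Delta> x (\<lambda>p q s. ten3 p q s + ten3 q s p + ten3 s p q))"

locale left_alia_bialgebra =
  left_alia_algebra scale B br + left_alia_coalgebra scale B \<Delta>
  for scale :: "'k::field_char_0 \<Rightarrow> 'b::ab_group_add \<Rightarrow> 'b" and B br \<Delta> +
  assumes compatible: "\<lbrakk>x \<in> B; y \<in> B\<rbrakk> \<Longrightarrow>
    (let t = \<Delta> (br x y - br y x);
         t' = map_tensor (\<lambda>z. br z y) id (\<Delta> x) - map_tensor (\<lambda>z. br z x) id (\<Delta> y)
     in eq_tensor2 scale B (flip_tensor t - t) (flip_tensor t' - t'))"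

locale nijenhuis_left_alia_bialgebra =
  left_alia_bialgebra scale B br \<Delta> + nijenhuis_left_alia_algebra scale B br M
  for scale :: "'k::field_char_0 \<Rightarrow> 'b::ab_group_add \<Rightarrow> 'b" and B br \<Delta> M +
  fixes P :: "'b \<Rightarrow> 'b"
  assumes linear_P: "linear_on scale B P"
    and admissible_P: "adjoint_admissible B br M P"
    and coproduct_P: "x \<in> B \<Longrightarrow> eq_tensor2 scale B
      (map_tensor P P (\<Delta> x) + \<Delta> (P (P x)))
      (map_tensor P id (\<Delta> (P x)) + map_tensor id P (\<Delta> (P x)))"
    and coproduct_PM: "x \<in> B \<Longrightarrow> eq_tensor2 scale B
      (map_tensor P id (\<Delta> (M x)) + map_tensor id (M \<circ> M) (\<Delta> x))
      (map_tensor P M (\<Delta> x) + map_tensor id M (\<Delta> (M x)))"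
    and coproduct_MP: "x \<in> B \<Longrightarrow> eq_tensor2 scale B
      (map_tensor id P (\<Delta> (M x)) + map_tensor (M \<circ> M) id (\<Delta> x))
      (map_tensor M P (\<Delta> x) + map_tensor M id (\<Delta> (M x)))"

end

theory Submission
  imports Defs
begin

text \<open>
  A tensor over \<open>B\<close> is zero exactly when every multilinear form on \<open>B\<close> vanishes on it, because a
  vector outside the span of the relators is separated from that span by a linear form
  (\<open>eq_tensor2_iff\<close>, \<open>eq_tensor3_iff\<close>). All identities of tensors therefore become identities
  between scalars, obtained by contracting multilinear forms with \<open>r\<close>.

  For the first part, a basis \<open>e\<close> of \<open>V\<close> with dual basis \<open>e\<^sup>*\<close> gives
  \<open>T\<^sub>\<sharp> = \<Sum> e\<^sup>* \<otimes> T e\<close>, and transposing an endomorphism \<open>\<sigma>\<close> of \<open>V\<close> in the first factor is the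
  same as applying it in the second: \<open>\<Sum> (e\<^sup>* \<circ> \<sigma>) \<otimes> T e = \<Sum> e\<^sup>* \<otimes> T (\<sigma> e)\<close>
  (\<open>transpose_contraction\<close>). With \<open>R(u, v) = [T u, T v] - T (\<ell>(T u) v + \<rho>(T v) u)\<close> this turns the
  Yang-Baxter tensor of \<open>r\<close> into a tensor with one component in each of \<open>A \<otimes> V\<^sup>* \<otimes> V\<^sup>*\<close>,
  \<open>V\<^sup>* \<otimes> A \<otimes> V\<^sup>*\<close> and \<open>V\<^sup>* \<otimes> V\<^sup>* \<otimes> A\<close>, given by the maps \<open>R(u, v)\<close>,
  \<open>R(u, v) - R(v, u)\<close> and \<open>-R(v, u)\<close> (\<open>tensor_eval_yang_baxter\<close>). It vanishes if and only if
  \<open>R = 0\<close>. In the same way the invariance of \<open>r\<close> splits into \<open>N T = T \<alpha>\<close> and \<open>T \<beta> = S T\<close>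
  (\<open>invariance_iff\<close>).

  The second part holds for an antisymmetric solution \<open>r\<close> in any \<open>P\<close>-adjoint-admissible Nijenhuis
  left Alia algebra (\<open>nijenhuis_coboundary_bialgebra\<close>). The compatibility of bracket and
  cobracket follows from antisymmetry and the left Alia identity. The coalgebra identity says that
  alternating trilinear forms vanish on \<open>(\<Delta> \<otimes> id) \<Delta> x\<close>; it follows from evaluating the
  Yang-Baxter tensor at \<open>\<Psi>([\<cdot>, x], \<cdot>, \<cdot>)\<close> with \<open>\<Psi>\<close> alternating (\<open>coboundary_coalia\<close>). Finally
  \<open>(P \<otimes> id) r = (id \<otimes> M) r\<close>, together with its flip \<open>(id \<otimes> P) r = (M \<otimes> id) r\<close>, lets
  one move the operators in each term of the three remaining conditions into one factor, where they are
  adjoint admissibility and the Nijenhuis identity. The semi-direct product meets the hypotheses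
  because \<open>V\<^sup>*\<close> is a representation of \<open>A\<close> whose axioms are the transposes of those of \<open>V\<close>.
\<close>

section \<open>Evaluating formal combinations\<close>

definition tensor_eval :: "('p \<Rightarrow>\<^sub>0 'k::field) \<Rightarrow> ('p \<Rightarrow> 'k) \<Rightarrow> 'k" where
  "tensor_eval t F = (\<Sum>p\<in>Poly_Mapping.keys t. Poly_Mapping.lookup t p * F p)"

text \<open>
  Sums over the support of a combination are awkward to add, since supports do not add up; over a
  common finite superset the addition is termwise.
\<close>

lemma tensor_eval_superset:
  assumes "finite X" "Poly_Mapping.keys t \<subseteq> X"
  shows "tensor_eval t F = (\<Sum>p\<in>X. Poly_Mapping.lookup t p * F p)"
  unfolding tensor_eval_def using assms
  by (intro sum.mono_neutral_left) (auto simp: in_keys_iff)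

lemma tensor_eval_zero [simp]: "tensor_eval 0 F = 0"
  by (simp add: tensor_eval_def)

lemma tensor_eval_add [simp]: "tensor_eval (s + t) F = tensor_eval s F + tensor_eval t F"
proof -
  let ?X = "Poly_Mapping.keys s \<union> Poly_Mapping.keys t"
  have "tensor_eval u F = (\<Sum>p\<in>?X. Poly_Mapping.lookup u p * F p)"
    if "Poly_Mapping.keys u \<subseteq> ?X" for u
    using that by (intro tensor_eval_superset) auto
  then show ?thesis
    using keys_add[of s t] by (simp add: lookup_add sum.distrib distrib_right)
qed

lemma tensor_eval_fscale [simp]: "tensor_eval (fscale c t) F = c * tensor_eval t F"
  by (subst tensor_eval_superset[where X = "Poly_Mapping.keys t"])
    (auto simp: in_keys_iff tensor_eval_def sum_distrib_left mult.assoc)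

lemma tensor_eval_minus [simp]: "tensor_eval (- t) F = - tensor_eval t F"
  using tensor_eval_add[of t "- t" F] by (simp add: eq_neg_iff_add_eq_0 add.commute)

lemma tensor_eval_diff [simp]: "tensor_eval (s - t) F = tensor_eval s F - tensor_eval t F"
  using tensor_eval_add[of s "- t" F] by simp

lemma tensor_eval_sum: "tensor_eval (sum t X) F = (\<Sum>i\<in>X. tensor_eval (t i) F)"
  by (induction X rule: infinite_finite_induct) auto

lemma tensor_eval_single [simp]: "tensor_eval (Poly_Mapping.single p c) F = c * F p"
  by (cases "c = 0") (auto simp: tensor_eval_def)

lemma tensor_eval_ten2 [simp]: "tensor_eval (ten2 x y) F = F (x, y)"
  by (simp add: ten2_def)

lemma tensor_eval_ten3 [simp]: "tensor_eval (ten3 x y z) F = F (x, y, z)"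
  by (simp add: ten3_def)

lemma tensor_eval_lext [simp]:
  "tensor_eval (lext t G) F = tensor_eval t (\<lambda>p. tensor_eval (G p) F)"
  by (simp add: lext_def tensor_eval_sum) (simp add: tensor_eval_def)

lemma tensor_eval_map_tensor [simp]:
  "tensor_eval (map_tensor f g t) F = tensor_eval t (\<lambda>(x, y). F (f x, g y))"
  by (simp add: map_tensor_def case_prod_unfold)

lemma tensor_eval_flip_tensor [simp]:
  "tensor_eval (flip_tensor t) F = tensor_eval t (\<lambda>(x, y). F (y, x))"
  by (simp add: flip_tensor_def case_prod_unfold)

lemma tensor_eval_cong:
  assumes "t \<in> tensors2 B C" "\<And>x y. x \<in> B \<Longrightarrow> y \<in> C \<Longrightarrow> F (x, y) = G (x, y)"
  shows "tensor_eval t F = tensor_eval t G"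
  unfolding tensor_eval_def using assms by (intro sum.cong) (auto simp: tensors2_def)

lemma tensor_eval_form_add:
  "tensor_eval t (\<lambda>p. F p + G p) = tensor_eval t F + tensor_eval t G"
  by (simp add: tensor_eval_def sum.distrib distrib_left)

lemma tensor_eval_form_diff:
  "tensor_eval t (\<lambda>p. F p - G p) = tensor_eval t F - tensor_eval t G"
  by (simp add: tensor_eval_def sum_subtractf right_diff_distrib)

lemma tensor_eval_form_minus: "tensor_eval t (\<lambda>p. - F p) = - tensor_eval t F"
  by (simp add: tensor_eval_def sum_negf)

lemma tensor_eval_form_scale: "tensor_eval t (\<lambda>p. c * F p) = c * tensor_eval t F"
  by (simp add: tensor_eval_def sum_distrib_left mult.left_commute)

lemma tensor_eval_swap:
  "tensor_eval s (\<lambda>p. tensor_eval t (F p)) = tensor_eval t (\<lambda>q. tensor_eval s (\<lambda>p. F p q))"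
  unfolding tensor_eval_def sum_distrib_left
  by (subst sum.swap) (simp add: mult.left_commute)

lemma tensors2_lext:
  assumes "\<And>p. p \<in> Poly_Mapping.keys t \<Longrightarrow> G p \<in> tensors2 B C"
  shows "lext t G \<in> tensors2 B C"
proof -
  have "Poly_Mapping.keys (fscale c (G p)) \<subseteq> B \<times> C" if "p \<in> Poly_Mapping.keys t" for c p
    using assms[OF that] by (auto simp: tensors2_def in_keys_iff)
  then show ?thesis
    unfolding lext_def tensors2_def using keys_sum by fastforce
qed

lemma tensors2_ten2: "x \<in> B \<Longrightarrow> y \<in> C \<Longrightarrow> ten2 x y \<in> tensors2 B C"
  by (simp add: tensors2_def ten2_def)

lemma tensors2_diff: "s \<in> tensors2 B C \<Longrightarrow> t \<in> tensors2 B C \<Longrightarrow> s - t \<in> tensors2 B C"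
  using keys_diff[of s t] by (auto simp: tensors2_def)

section \<open>Equality of tensors is detected by multilinear forms\<close>

definition linear_form_on ::
  "('k::field \<Rightarrow> 'b::ab_group_add \<Rightarrow> 'b) \<Rightarrow> 'b set \<Rightarrow> ('b \<Rightarrow> 'k) \<Rightarrow> bool" where
  "linear_form_on scale B g \<longleftrightarrow>
     (\<forall>x\<in>B. \<forall>y\<in>B. g (x + y) = g x + g y) \<and> (\<forall>c. \<forall>x\<in>B. g (scale c x) = c * g x)"

definition bilinear_form_on ::
  "('k::field \<Rightarrow> 'b::ab_group_add \<Rightarrow> 'b) \<Rightarrow> 'b set \<Rightarrow> ('b \<Rightarrow> 'b \<Rightarrow> 'k) \<Rightarrow> bool" where
  "bilinear_form_on scale B F \<longleftrightarrow>
     (\<forall>y\<in>B. linear_form_on scale B (\<lambda>x. F x y)) \<and> (\<forall>x\<in>B. linear_form_on scale B (\<lambda>y. F x y))"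

definition trilinear_form_on ::
  "('k::field \<Rightarrow> 'b::ab_group_add \<Rightarrow> 'b) \<Rightarrow> 'b set \<Rightarrow> ('b \<Rightarrow> 'b \<Rightarrow> 'b \<Rightarrow> 'k) \<Rightarrow> bool" where
  "trilinear_form_on scale B F \<longleftrightarrow>
     (\<forall>y\<in>B. \<forall>z\<in>B. linear_form_on scale B (\<lambda>x. F x y z)) \<and>
     (\<forall>x\<in>B. \<forall>z\<in>B. linear_form_on scale B (\<lambda>y. F x y z)) \<and>
     (\<forall>x\<in>B. \<forall>y\<in>B. linear_form_on scale B (\<lambda>z. F x y z))"

lemma linear_form_onD:
  assumes "linear_form_on scale B g"
  shows "x \<in> B \<Longrightarrow> y \<in> B \<Longrightarrow> g (x + y) = g x + g y"
    and "x \<in> B \<Longrightarrow> g (scale c x) = c * g x"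
  using assms by (auto simp: linear_form_on_def)

lemma vector_space_field: "vector_space ((*) :: 'k::field \<Rightarrow> 'k \<Rightarrow> 'k)"
  by unfold_locales (auto simp: algebra_simps)

text \<open>Extend a basis of the span by \<open>w\<close>, and take the form that is \<open>1\<close> on \<open>w\<close> and \<open>0\<close> on that
  basis.\<close>

lemma (in vector_space) separating_form:
  assumes "w \<notin> span W"
  obtains g where "Vector_Spaces.linear scale (*) g" "g w = 1" "\<And>x. x \<in> span W \<Longrightarrow> g x = 0"
proof -
  interpret vector_space_pair scale "(*)"
    by (intro vector_space_pair.intro vector_space_axioms vector_space_field)
  obtain C where C: "C \<subseteq> W" "independent C" "W \<subseteq> span C"
    by (rule maximal_independent_subset)
  have span: "span C = span W"
    using C by (meson span_mono span_minimal subspace_span subset_antisym)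
  have "independent (insert w C)"
    using C assms span by (simp add: independent_insertI)
  then obtain g where g: "Vector_Spaces.linear scale (*) g"
    "\<forall>x\<in>insert w C. g x = (if x = w then 1 else 0)"
    using linear_independent_extend[of "insert w C" "\<lambda>x. if x = w then 1 else 0"] by blast
  have "\<forall>x\<in>C. g x = 0"
    using g assms span span_base by auto
  then have "g x = 0" if "x \<in> span W" for x
    using linear_eq_0_on_span[OF g(1), of C x] that span by auto
  with g show thesis by (intro that[of g]) auto
qed

text \<open>
  The elementary combinations span, so a linear form on formal combinations is the evaluation of its
  values on them.
\<close>

lemma linear_on_formal_combinations:
  assumes "Vector_Spaces.linear fscale (*) g"
  shows "g t = tensor_eval t (\<lambda>p. g (Poly_Mapping.single p 1))"
proof -
  interpret Vector_Spaces.linear fscale "(*)" g by fact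
  have *: "fscale c (Poly_Mapping.single p 1) = Poly_Mapping.single p c" for c p
    by (auto intro!: poly_mapping_eqI simp: lookup_single when_def)
  have "t = (\<Sum>p\<in>Poly_Mapping.keys t. fscale (Poly_Mapping.lookup t p) (Poly_Mapping.single p 1))"
    unfolding * by (auto intro!: poly_mapping_eqI simp: lookup_sum lookup_single when_def in_keys_iff)
  then have "g t = g (\<Sum>p\<in>Poly_Mapping.keys t. fscale (Poly_Mapping.lookup t p) (Poly_Mapping.single p 1))"
    by simp
  then show ?thesis by (simp add: sum scale tensor_eval_def)
qed

text \<open>
  Evaluations that are linear in every slot kill the relators, hence their span. Conversely a linear
  form separating \<open>t\<close> from that span is itself such an evaluation, as it kills the relators. This
  replaces the construction of the tensor product as a quotient.
\<close>

lemma multilinear_relators_span_iff: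
  "t \<in> formal.span (multilinear_relators scale B slots) \<longleftrightarrow>
   (\<forall>F. (\<forall>\<phi>\<in>slots. linear_form_on scale B (\<lambda>x. tensor_eval (\<phi> x) F)) \<longrightarrow> tensor_eval t F = 0)"
  (is "?L \<longleftrightarrow> ?R")
proof
  assume ?L
  show ?R
  proof (intro allI impI)
    fix F assume F: "\<forall>\<phi>\<in>slots. linear_form_on scale B (\<lambda>x. tensor_eval (\<phi> x) F)"
    have "tensor_eval u F = 0" if "u \<in> multilinear_relators scale B slots" for u
      using that F by (auto simp: multilinear_relators_def linear_form_on_def)
    with \<open>?L\<close> show "tensor_eval t F = 0"
      by (induction rule: formal.span_induct_alt) auto
  qed
next
  assume R: ?R
  show ?L
  proof (rule ccontr)
    assume "\<not> ?L"
    then obtain g where g: "Vector_Spaces.linear fscale (*) g" "g t = 1"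
      "\<And>x. x \<in> formal.span (multilinear_relators scale B slots) \<Longrightarrow> g x = 0"
      using formal.separating_form by blast
    interpret Vector_Spaces.linear fscale "(*)" g by fact
    define F where "F p = g (Poly_Mapping.single p 1)" for p
    have eval: "g u = tensor_eval u F" for u
      unfolding F_def using g(1) by (rule linear_on_formal_combinations)
    have rel: "g u = 0" if "u \<in> multilinear_relators scale B slots" for u
      using that formal.span_base g(3) by blast
    have "\<phi> (x + y) - \<phi> x - \<phi> y \<in> multilinear_relators scale B slots"
         "\<phi> (scale c x) - fscale c (\<phi> x) \<in> multilinear_relators scale B slots"
      if "\<phi> \<in> slots" "x \<in> B" "y \<in> B" for \<phi> c x y
      unfolding multilinear_relators_def using that by auto
    note rel[OF this(1)] rel[OF this(2)]
    then have "\<forall>\<phi>\<in>slots. linear_form_on scale B (\<lambda>x. g (\<phi> x))"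
      unfolding linear_form_on_def by (auto simp: diff add scale algebra_simps)
    with R have "tensor_eval t F = 0" by (simp add: eval)
    with g(2) eval show False by simp
  qed
qed

lemma eq_tensor2_iff:
  fixes scale :: "'k::field \<Rightarrow> 'b::ab_group_add \<Rightarrow> 'b"
  shows "eq_tensor2 scale B s t \<longleftrightarrow>
   (\<forall>F. bilinear_form_on scale B F \<longrightarrow>
     tensor_eval s (\<lambda>(x, y). F x y) = tensor_eval t (\<lambda>(x, y). F x y))"
proof -
  have "(\<forall>\<phi>\<in>slots2 B. linear_form_on scale B (\<lambda>x. tensor_eval (\<phi> x) (\<lambda>(x, y). F x y))) \<longleftrightarrow>
      bilinear_form_on scale B F" for F
  proof -
    have "(\<forall>\<phi>\<in>slots2 B. Q \<phi>) \<longleftrightarrow>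
      (\<forall>y\<in>B. Q (\<lambda>x. ten2 x y)) \<and> (\<forall>x\<in>B. Q (\<lambda>y. ten2 x y))" for Q :: "('b \<Rightarrow> 'b \<times> 'b \<Rightarrow>\<^sub>0 'k) \<Rightarrow> bool"
      unfolding slots2_def by blast
    then show ?thesis by (simp add: bilinear_form_on_def)
  qed
  moreover have "(\<forall>F. Q F) \<longleftrightarrow> (\<forall>F. Q (\<lambda>(x, y). F x y))" for Q :: "('b \<times> 'b \<Rightarrow> 'k) \<Rightarrow> bool"
    by (metis case_prod_curry)
  ultimately show ?thesis
    unfolding eq_tensor2_def multilinear_relators_span_iff by simp
qed

lemma eq_tensor3_iff:
  fixes scale :: "'k::field \<Rightarrow> 'b::ab_group_add \<Rightarrow> 'b"
  shows "eq_tensor3 scale B s t \<longleftrightarrow>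
   (\<forall>F. trilinear_form_on scale B F \<longrightarrow>
     tensor_eval s (\<lambda>(x, y, z). F x y z) = tensor_eval t (\<lambda>(x, y, z). F x y z))"
proof -
  have "(\<forall>\<phi>\<in>slots3 B. linear_form_on scale B (\<lambda>x. tensor_eval (\<phi> x) (\<lambda>(x, y, z). F x y z))) \<longleftrightarrow>
      trilinear_form_on scale B F" for F
  proof -
    have "(\<forall>\<phi>\<in>slots3 B. Q \<phi>) \<longleftrightarrow>
      (\<forall>y\<in>B. \<forall>z\<in>B. Q (\<lambda>x. ten3 x y z)) \<and> (\<forall>x\<in>B. \<forall>z\<in>B. Q (\<lambda>y. ten3 x y z)) \<and>
      (\<forall>x\<in>B. \<forall>y\<in>B. Q (\<lambda>z. ten3 x y z))" for Q :: "('b \<Rightarrow> 'b \<times> 'b \<times> 'b \<Rightarrow>\<^sub>0 'k) \<Rightarrow> bool"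
      unfolding slots3_def by blast
    then show ?thesis by (simp add: trilinear_form_on_def)
  qed
  moreover have "(\<forall>F. Q F) \<longleftrightarrow> (\<forall>F. Q (\<lambda>(x, y, z). F x y z))"
    for Q :: "('b \<times> 'b \<times> 'b \<Rightarrow> 'k) \<Rightarrow> bool"
  proof
    assume Q: "\<forall>F. Q (\<lambda>(x, y, z). F x y z)"
    show "\<forall>F. Q F"
    proof
      fix F :: "'b \<times> 'b \<times> 'b \<Rightarrow> 'k"
      have "F = (\<lambda>(x, y, z). F (x, y, z))" by auto
      then show "Q F" using spec[OF Q, of "\<lambda>x y z. F (x, y, z)"] by simp
    qed
  qed simp
  ultimately show ?thesis
    unfolding eq_tensor3_def multilinear_relators_span_iff by simp
qed

section \<open>Coboundary bialgebras from antisymmetric tensors\<close>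

lemma bilinear_form_onD:
  assumes "bilinear_form_on scale B F"
  shows "x \<in> B \<Longrightarrow> y \<in> B \<Longrightarrow> z \<in> B \<Longrightarrow> F (x + y) z = F x z + F y z"
    and "x \<in> B \<Longrightarrow> y \<in> B \<Longrightarrow> z \<in> B \<Longrightarrow> F x (y + z) = F x y + F x z"
    and "x \<in> B \<Longrightarrow> y \<in> B \<Longrightarrow> F (scale c x) y = c * F x y"
    and "x \<in> B \<Longrightarrow> y \<in> B \<Longrightarrow> F x (scale c y) = c * F x y"
  using assms by (auto simp: bilinear_form_on_def linear_form_on_def)

lemma trilinear_form_onD:
  assumes "trilinear_form_on scale B F"
  shows "z \<in> B \<Longrightarrow> bilinear_form_on scale B (\<lambda>x y. F x y z)"
    and "y \<in> B \<Longrightarrow> bilinear_form_on scale B (\<lambda>x z. F x y z)"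
    and "x \<in> B \<Longrightarrow> bilinear_form_on scale B (F x)"
  using assms by (auto simp: trilinear_form_on_def bilinear_form_on_def)

lemma bilinear_form_on_compose:
  assumes "bilinear_form_on scale B F" "linear_on scale B f" "linear_on scale B g"
  shows "bilinear_form_on scale B (\<lambda>x y. F (f x) (g y))"
  using assms by (auto simp: bilinear_form_on_def linear_form_on_def linear_on_def)

lemma bilinear_form_on_compose_flip:
  assumes "bilinear_form_on scale B F" "linear_on scale B f" "linear_on scale B g"
  shows "bilinear_form_on scale B (\<lambda>x y. F (f y) (g x))"
  using bilinear_form_on_compose[OF assms] by (auto simp: bilinear_form_on_def)

lemma trilinear_form_on_compose:
  assumes "trilinear_form_on scale B F" "linear_on scale B f" "linear_on scale B g"
    "linear_on scale B h"
  shows "trilinear_form_on scale B (\<lambda>x y z. F (f x) (g y) (h z))"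
  using assms by (auto simp: trilinear_form_on_def linear_form_on_def linear_on_def)

lemma bilinear_form_on_add:
  assumes "bilinear_form_on scale B F" "bilinear_form_on scale B G"
  shows "bilinear_form_on scale B (\<lambda>x y. F x y + G x y)"
    and "bilinear_form_on scale B (\<lambda>x y. F x y - G x y)"
  using assms by (auto simp: bilinear_form_on_def linear_form_on_def algebra_simps)

lemma linear_on_id: "linear_on scale B (\<lambda>x. x)"
  by (simp add: linear_on_def)

lemma linear_on_compose:
  "linear_on scale B f \<Longrightarrow> linear_on scale B g \<Longrightarrow> linear_on scale B (\<lambda>x. f (g x))"
  by (simp add: linear_on_def)

lemma linear_onD:
  assumes "linear_on scale B f"
  shows "x \<in> B \<Longrightarrow> f x \<in> B"
    and "x \<in> B \<Longrightarrow> y \<in> B \<Longrightarrow> f (x + y) = f x + f y"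
    and "x \<in> B \<Longrightarrow> f (scale c x) = scale c (f x)"
  using assms by (auto simp: linear_on_def)

context vector_space
begin

lemma linear_on_minus:
  assumes "subspace B" "linear_on scale B f" "x \<in> B" "y \<in> B"
  shows "f (x - y) = f x - f y"
proof -
  have "f (x + scale (-1) y) = f x + scale (-1) (f y)"
    using assms by (simp only: linear_onD[OF assms(2)] subspace_scale)
  then show ?thesis by simp
qed

lemma linear_form_on_minus:
  assumes "subspace B" "linear_form_on scale B f" "x \<in> B" "y \<in> B"
  shows "f (x - y) = f x - f y"
proof -
  have "f (x + scale (-1) y) = f x + (-1) * f y"
    using assms by (simp only: linear_form_onD[OF assms(2)] subspace_scale)
  then show ?thesis by simp
qed

lemma bilinear_form_on_minus:
  assumes "subspace B" "bilinear_form_on scale B F" "x \<in> B" "y \<in> B" "z \<in> B"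
  shows "F (x - y) z = F x z - F y z" and "F x (y - z) = F x y - F x z"
  using assms linear_form_on_minus[of B "\<lambda>x. F x z" x y] linear_form_on_minus[of B "F x" y z]
  by (auto simp: bilinear_form_on_def)

lemma linear_on_diff:
  assumes "subspace B" "linear_on scale B f" "linear_on scale B g"
  shows "linear_on scale B (\<lambda>x. f x - g x)"
  using assms
  by (simp add: linear_on_def subspace_diff algebra_simps scale_right_diff_distrib)

end

context left_alia_algebra
begin

lemma linear_on_right_mult: "x \<in> B \<Longrightarrow> linear_on scale B (\<lambda>z. br z x)"
  and linear_on_left_mult: "x \<in> B \<Longrightarrow> linear_on scale B (\<lambda>z. br x z)"
  by (auto simp: linear_on_def closed add_left add_right scale_left scale_right)

lemma bracket_minus:
  assumes "x \<in> B" "y \<in> B" "z \<in> B"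
  shows "br (x - y) z = br x z - br y z" "br x (y - z) = br x y - br x z"
  using assms linear_on_minus[OF subspace linear_on_right_mult[of z], of x y]
    linear_on_minus[OF subspace linear_on_left_mult[of x], of y z] by auto

lemma linear_on_bracket:
  assumes "x \<in> B" "linear_on scale B f"
  shows "linear_on scale B (\<lambda>z. br (f z) x)" and "linear_on scale B (\<lambda>z. br x (f z))"
  using assms linear_on_compose linear_on_right_mult linear_on_left_mult by blast+

lemma commutator_closed: "x \<in> B \<Longrightarrow> y \<in> B \<Longrightarrow> br x y - br y x \<in> B"
  by (intro subspace_diff subspace closed)

lemmas linear_intros = linear_on_id linear_on_bracket linear_on_diff[OF subspace]

end

text \<open>
  For \<open>r = \<Sum> a \<otimes> b\<close>, \<open>contract F\<close> below is \<open>\<Sum> F(a, b)\<close>. Identities between elements of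
  \<open>B \<otimes> B\<close> of the form \<open>(f \<otimes> g) r\<close> become identities between contractions of \<open>F(f a, g b)\<close> for
  an arbitrary bilinear form \<open>F\<close>.
\<close>

locale antisymmetric_tensor_algebra = left_alia_algebra scale B br
  for scale :: "'k::field_char_0 \<Rightarrow> 'b::ab_group_add \<Rightarrow> 'b" and B br +
  fixes r :: "'b \<times> 'b \<Rightarrow>\<^sub>0 'k"
  assumes r_in: "r \<in> tensors2 B B"
    and antisymmetric: "antisymmetric_tensor scale B r"
begin

abbreviation D :: "'b \<Rightarrow> 'b \<Rightarrow> 'b" where "D x z \<equiv> br z x - br x z"

abbreviation \<Delta> :: "'b \<Rightarrow> 'b \<times> 'b \<Rightarrow>\<^sub>0 'k" where "\<Delta> \<equiv> coboundary br r"

definition contract :: "('b \<Rightarrow> 'b \<Rightarrow> 'k) \<Rightarrow> 'k" where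
  "contract F = tensor_eval r (\<lambda>(a, b). F a b)"

lemma contract_cong:
  "(\<And>a b. a \<in> B \<Longrightarrow> b \<in> B \<Longrightarrow> F a b = G a b) \<Longrightarrow> contract F = contract G"
  unfolding contract_def by (rule tensor_eval_cong[OF r_in]) auto

lemma contract_add: "contract (\<lambda>a b. F a b + G a b) = contract F + contract G"
  and contract_diff: "contract (\<lambda>a b. F a b - G a b) = contract F - contract G"
  and contract_minus: "contract (\<lambda>a b. - F a b) = - contract F"
  and contract_scale: "contract (\<lambda>a b. c * F a b) = c * contract F"
  by (simp_all add: contract_def case_prod_unfold tensor_eval_form_add tensor_eval_form_diff
      tensor_eval_form_minus tensor_eval_form_scale)

lemma contract_swap:
  "contract (\<lambda>a b. contract (\<lambda>a' b'. H a b a' b')) =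
   contract (\<lambda>a b. contract (\<lambda>a' b'. H a' b' a b))"
  unfolding contract_def case_prod_unfold by (rule tensor_eval_swap)

lemma contract_antisymmetric:
  assumes "bilinear_form_on scale B F"
  shows "contract F = - contract (\<lambda>a b. F b a)"
proof -
  have "tensor_eval r (\<lambda>(a, b). F a b) + tensor_eval r (\<lambda>(a, b). F b a) = 0"
    using antisymmetric assms unfolding antisymmetric_tensor_def eq_tensor2_iff by auto
  then show ?thesis by (simp add: contract_def eq_neg_iff_add_eq_0)
qed

text \<open>
  Double contractions are needed for the terms of degree two in \<open>r\<close>; with this closure property the
  antisymmetry of \<open>r\<close> can be used in the outer contraction as well as in the inner one.
\<close>

lemma bilinear_form_on_contract:
  assumes "\<And>a' b'. a' \<in> B \<Longrightarrow> b' \<in> B \<Longrightarrow> bilinear_form_on scale B (\<lambda>a b. H a b a' b')"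
  shows "bilinear_form_on scale B (\<lambda>a b. contract (H a b))"
proof -
  have "contract (H (x + y) z) = contract (H x z) + contract (H y z)"
    "contract (H x (y + z)) = contract (H x y) + contract (H x z)"
    "contract (H (scale c x) z) = c * contract (H x z)"
    "contract (H x (scale c z)) = c * contract (H x z)"
    if "x \<in> B" "y \<in> B" "z \<in> B" for x y z c
    unfolding contract_add[symmetric] contract_scale[symmetric]
    using that by (auto intro!: contract_cong simp: bilinear_form_onD[OF assms])
  then show ?thesis
    by (auto simp: bilinear_form_on_def linear_form_on_def)
qed

lemma tensor_eval_coboundary:
  "tensor_eval (\<Delta> x) (\<lambda>(p, q). G p q) = contract (\<lambda>a b. G (D x a) b - G a (br b x))"
  by (simp add: coboundary_def contract_def case_prod_unfold)

text \<open>
  By antisymmetry the terms of \<open>\<Delta> x\<close> with \<open>[\<cdot>, x]\<close> cancel against those of its flip, and what is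
  left is \<open>(L(x) \<otimes> id + id \<otimes> L(x)) r\<close> for the left multiplication \<open>L(x)\<close>.
\<close>

lemma contract_skew_coboundary:
  assumes F: "bilinear_form_on scale B F" and x: "x \<in> B"
  shows "contract (\<lambda>a b. F b (D x a) - F (br b x) a) - contract (\<lambda>a b. F (D x a) b - F a (br b x)) =
    contract (\<lambda>a b. F (br x a) b + F a (br x b))"
proof -
  have "contract (\<lambda>a b. F b (D x a)) = - contract (\<lambda>a b. F a (D x b))"
    by (rule contract_antisymmetric[where F = "\<lambda>a b. F b (D x a)"])
      (intro bilinear_form_on_compose_flip[OF F] linear_intros x)
  moreover have "contract (\<lambda>a b. F (br b x) a) = - contract (\<lambda>a b. F (br a x) b)"
    by (rule contract_antisymmetric[where F = "\<lambda>a b. F (br b x) a"])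
      (intro bilinear_form_on_compose_flip[OF F] linear_intros x)
  moreover have "contract (\<lambda>a b. F (D x a) b) = contract (\<lambda>a b. F (br a x) b - F (br x a) b)"
    "contract (\<lambda>a b. F a (D x b)) = contract (\<lambda>a b. F a (br b x) - F a (br x b))"
    using x by (auto intro!: contract_cong simp: closed bilinear_form_on_minus[OF subspace F])
  ultimately show ?thesis
    by (simp add: contract_diff contract_add)
qed

lemma coboundary_linear:
  assumes F: "bilinear_form_on scale B F" and "x \<in> B" "y \<in> B"
  shows "tensor_eval (\<Delta> (x + y)) (\<lambda>(p, q). F p q) =
      tensor_eval (\<Delta> x) (\<lambda>(p, q). F p q) + tensor_eval (\<Delta> y) (\<lambda>(p, q). F p q)"
    and "tensor_eval (\<Delta> (scale c x)) (\<lambda>(p, q). F p q) = c * tensor_eval (\<Delta> x) (\<lambda>(p, q). F p q)"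
proof -
  have "G (D (x + y) a) b - G a (br b (x + y)) =
      (G (D x a) b - G a (br b x)) + (G (D y a) b - G a (br b y))"
    "G (D (scale c x) a) b - G a (br b (scale c x)) = c * (G (D x a) b - G a (br b x))"
    if G: "bilinear_form_on scale B G" and "a \<in> B" "b \<in> B" for a b G
    using that assms(2,3)
    by (simp_all add: closed subspace_add[OF subspace] subspace_scale[OF subspace] add_left add_right
        scale_left scale_right bilinear_form_onD[OF G] bilinear_form_on_minus[OF subspace G]
        right_diff_distrib)
  note F' = this[OF F]
  show "tensor_eval (\<Delta> (x + y)) (\<lambda>(p, q). F p q) =
      tensor_eval (\<Delta> x) (\<lambda>(p, q). F p q) + tensor_eval (\<Delta> y) (\<lambda>(p, q). F p q)"
    unfolding tensor_eval_coboundary contract_add[symmetric] by (rule contract_cong) (rule F'(1))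
  show "tensor_eval (\<Delta> (scale c x)) (\<lambda>(p, q). F p q) = c * tensor_eval (\<Delta> x) (\<lambda>(p, q). F p q)"
    unfolding tensor_eval_coboundary contract_scale[symmetric] by (rule contract_cong) (rule F'(2))
qed

lemma coboundary_closed:
  assumes "x \<in> B"
  shows "\<Delta> x \<in> tensors2 B B"
  unfolding coboundary_def
proof (rule tensors2_lext, clarify)
  fix a b assume "(a, b) \<in> Poly_Mapping.keys r"
  then have "a \<in> B" "b \<in> B" using r_in by (auto simp: tensors2_def)
  with assms show "ten2 (D x a) b - ten2 a (br b x) \<in> tensors2 B B"
    by (intro tensors2_diff tensors2_ten2 commutator_closed closed)
qed

text \<open>
  After skew-symmetrisation the mixed terms \<open>[a, x] \<otimes> [b, y]\<close> cancel in pairs. Both sides then have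
  the form \<open>(f \<otimes> id + id \<otimes> f) r\<close>, with \<open>f\<close> the left multiplication by \<open>[x, y] - [y, x]\<close>
  on the left and the commutator expression \<open>[D y \<cdot>, x] - [D x \<cdot>, y]\<close> on the right. These maps agree
  by the left Alia identity.
\<close>

lemma coboundary_compatible:
  assumes x: "x \<in> B" and y: "y \<in> B"
  shows "let t = \<Delta> (br x y - br y x);
         t' = map_tensor (\<lambda>z. br z y) id (\<Delta> x) - map_tensor (\<lambda>z. br z x) id (\<Delta> y)
     in eq_tensor2 scale B (flip_tensor t - t) (flip_tensor t' - t')"
  unfolding Let_def eq_tensor2_iff
proof (intro allI impI)
  fix F assume F: "bilinear_form_on scale B F"
  let ?w = "br x y - br y x"
  have w: "?w \<in> B" by (intro commutator_closed x y)
  have key: "br ?w z = br (D y z) x - br (D x z) y" if z: "z \<in> B" for z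
    using alia[OF x y z] x y z by (simp add: bracket_minus closed algebra_simps)
  have flips: "contract (\<lambda>a b. F b (br (D x a) y)) = - contract (\<lambda>a b. F a (br (D x b) y))"
    "contract (\<lambda>a b. F b (br (D y a) x)) = - contract (\<lambda>a b. F a (br (D y b) x))"
    "contract (\<lambda>a b. F (br b x) (br a y)) = - contract (\<lambda>a b. F (br a x) (br b y))"
    "contract (\<lambda>a b. F (br b y) (br a x)) = - contract (\<lambda>a b. F (br a y) (br b x))"
    by (rule contract_antisymmetric,
        intro bilinear_form_on_compose_flip[OF F] linear_intros x y)+
  have alia: "contract (\<lambda>a b. F (br ?w a) b) =
      contract (\<lambda>a b. F (br (D y a) x) b) - contract (\<lambda>a b. F (br (D x a) y) b)"
    "contract (\<lambda>a b. F a (br ?w b)) =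
      contract (\<lambda>a b. F a (br (D y b) x)) - contract (\<lambda>a b. F a (br (D x b) y))"
    unfolding contract_diff[symmetric]
    by (rule contract_cong, simp only: key closed commutator_closed x y
        bilinear_form_on_minus[OF subspace F])+
  show "tensor_eval (flip_tensor (\<Delta> ?w) - \<Delta> ?w) (\<lambda>(x, y). F x y) =
    tensor_eval (flip_tensor (map_tensor (\<lambda>z. br z y) id (\<Delta> x) - map_tensor (\<lambda>z. br z x) id (\<Delta> y)) -
      (map_tensor (\<lambda>z. br z y) id (\<Delta> x) - map_tensor (\<lambda>z. br z x) id (\<Delta> y))) (\<lambda>(x, y). F x y)"
    using contract_skew_coboundary[OF F w]
    by (simp add: tensor_eval_coboundary contract_diff contract_add flips alia)
qed

text \<open>
  For a form \<open>\<Psi>\<close> that is skew in its first two arguments, skewness of \<open>\<Psi>\<close> and antisymmetry of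
  \<open>r\<close> compensate each other, so that \<open>id \<otimes> R(y)\<close> may be replaced by \<open>R(y) \<otimes> id\<close>, where
  \<open>R(y)\<close> is the right multiplication.
\<close>

lemma contract_alternating_coboundary:
  assumes \<Psi>: "trilinear_form_on scale B \<Psi>"
    and skew: "\<And>p q s. \<Psi> q p s = - \<Psi> p q s"
    and "y \<in> B" "s \<in> B"
  shows "tensor_eval (\<Delta> y) (\<lambda>(p, q). \<Psi> p q s) = - contract (\<lambda>a b. \<Psi> (br y a) b s)"
proof -
  note \<Psi>s = trilinear_form_onD(1)[OF \<Psi> \<open>s \<in> B\<close>]
  have "contract (\<lambda>a b. \<Psi> a (br b y) s) = - contract (\<lambda>a b. \<Psi> b (br a y) s)"
    by (rule contract_antisymmetric) (intro bilinear_form_on_compose[OF \<Psi>s] linear_intros assms)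
  also have "\<dots> = contract (\<lambda>a b. \<Psi> (br a y) b s)"
    by (subst skew) (simp add: contract_minus)
  finally have "contract (\<lambda>a b. \<Psi> a (br b y) s) = contract (\<lambda>a b. \<Psi> (br a y) b s)" .
  moreover have "contract (\<lambda>a b. \<Psi> (D y a) b s) =
      contract (\<lambda>a b. \<Psi> (br a y) b s) - contract (\<lambda>a b. \<Psi> (br y a) b s)"
    unfolding contract_diff[symmetric]
    using assms(3) by (intro contract_cong bilinear_form_on_minus[OF subspace \<Psi>s] closed)
  ultimately show ?thesis
    by (simp add: tensor_eval_coboundary contract_diff)
qed

text \<open>
  The two sides of the coalgebra identity differ by the alternating sum of
  \<open>(\<Delta> \<otimes> id) \<Delta> x\<close> over all permutations of the factors, so only alternating forms \<open>\<Psi>\<close> have to be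
  tested. On those, the left Alia identity for \<open>a\<close>, \<open>x\<close>, \<open>a'\<close> reduces the test to the
  Yang-Baxter tensor evaluated at \<open>\<Psi>([\<cdot>, x], \<cdot>, \<cdot>)\<close>.
\<close>

lemma coboundary_coalia:
  assumes yang_baxter: "eq_tensor3 scale B (yang_baxter_tensor br r) 0" and x: "x \<in> B"
  shows "eq_tensor3 scale B
      (iterated_coproduct \<Delta> x (\<lambda>p q s. ten3 q p s + ten3 p s q + ten3 s q p))
      (iterated_coproduct \<Delta> x (\<lambda>p q s. ten3 p q s + ten3 q s p + ten3 s p q))"
  unfolding eq_tensor3_iff
proof (intro allI impI)
  fix \<Phi> assume \<Phi>: "trilinear_form_on scale B \<Phi>"
  define \<Psi> where "\<Psi> p q s =
    (\<Phi> q p s + \<Phi> p s q + \<Phi> s q p) - (\<Phi> p q s + \<Phi> q s p + \<Phi> s p q)" for p q s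
  have skew: "\<Psi> q p s = - \<Psi> p q s" "\<Psi> p s q = - \<Psi> p q s" for p q s
    by (simp_all add: \<Psi>_def)
  have \<Psi>: "trilinear_form_on scale B \<Psi>"
    using \<Phi> unfolding trilinear_form_on_def linear_form_on_def \<Psi>_def
    by (auto simp: algebra_simps)
  note \<Psi>1 = trilinear_form_onD(1)[OF \<Psi>] and \<Psi>2 = trilinear_form_onD(2)[OF \<Psi>]
    and \<Psi>3 = trilinear_form_onD(3)[OF \<Psi>]
  define Q where "Q H = contract (\<lambda>a b. contract (\<lambda>a' b'. H a b a' b'))"
    for H :: "'b \<Rightarrow> 'b \<Rightarrow> 'b \<Rightarrow> 'b \<Rightarrow> 'k"
  have Q_cong: "Q H = Q H'" if "\<And>a b a' b'. a \<in> B \<Longrightarrow> b \<in> B \<Longrightarrow> a' \<in> B \<Longrightarrow> b' \<in> B \<Longrightarrow>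
      H a b a' b' = H' a b a' b'" for H H'
    unfolding Q_def using that by (intro contract_cong) auto
  have Q_add: "Q (\<lambda>a b a' b'. H a b a' b' + H' a b a' b') = Q H + Q H'"
    and Q_diff: "Q (\<lambda>a b a' b'. H a b a' b' - H' a b a' b') = Q H - Q H'"
    and Q_minus: "Q (\<lambda>a b a' b'. - H a b a' b') = - Q H" for H H'
    by (simp_all add: Q_def contract_add contract_diff contract_minus)
  have Q_swap: "Q H = Q (\<lambda>a b a' b'. H a' b' a b)" for H
    unfolding Q_def by (rule contract_swap)
  have Q_outer: "Q H = - Q (\<lambda>a b a' b'. H b a a' b')"
    if "\<And>a' b'. a' \<in> B \<Longrightarrow> b' \<in> B \<Longrightarrow> bilinear_form_on scale B (\<lambda>a b. H a b a' b')" for H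
    unfolding Q_def by (rule contract_antisymmetric) (rule bilinear_form_on_contract, rule that)
  have Q_inner: "Q H = - Q (\<lambda>a b a' b'. H a b b' a')"
    if "\<And>a b. a \<in> B \<Longrightarrow> b \<in> B \<Longrightarrow> bilinear_form_on scale B (H a b)" for H
  proof -
    have "Q H = contract (\<lambda>a b. - contract (\<lambda>a' b'. H a b b' a'))"
      unfolding Q_def by (rule contract_cong, rule contract_antisymmetric, rule that)
    then show ?thesis by (simp add: Q_def contract_minus)
  qed

  have "tensor_eval (iterated_coproduct \<Delta> x (\<lambda>p q s. ten3 q p s + ten3 p s q + ten3 s q p))
        (\<lambda>(x, y, z). \<Phi> x y z) -
      tensor_eval (iterated_coproduct \<Delta> x (\<lambda>p q s. ten3 p q s + ten3 q s p + ten3 s p q))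
        (\<lambda>(x, y, z). \<Phi> x y z) =
      tensor_eval (\<Delta> x) (\<lambda>(y, s). tensor_eval (\<Delta> y) (\<lambda>(p, q). \<Psi> p q s))"
    by (simp add: iterated_coproduct_def case_prod_unfold tensor_eval_form_diff[symmetric] \<Psi>_def)
  also have "\<dots> = tensor_eval (\<Delta> x) (\<lambda>(y, s). - contract (\<lambda>a b. \<Psi> (br y a) b s))"
    by (rule tensor_eval_cong[OF coboundary_closed[OF x]])
      (auto intro: contract_alternating_coboundary[OF \<Psi> skew(1)])
  also have "\<dots> = Q (\<lambda>a b a' b'. \<Psi> (br a a') b' (br b x)) - Q (\<lambda>a b a' b'. \<Psi> (br (D x a) a') b' b)"
    by (simp add: tensor_eval_coboundary Q_def contract_diff contract_minus)
  also have "\<dots> = 0"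
  proof -
    \<comment> \<open>The value is \<open>- Z - E\<close>, with \<open>E\<close> introduced below. The left Alia identity gives
      \<open>E = - Y\<close>, and the Yang-Baxter equation gives \<open>Y = Z\<close>, its remaining terms with \<open>Z'\<close>
      cancelling.\<close>
    define Z where "Z = Q (\<lambda>a b a' b'. \<Psi> (br a a') (br b x) b')"
    define Z' where "Z' = Q (\<lambda>a b a' b'. \<Psi> (br a' a) (br b x) b')"
    define Y where "Y = Q (\<lambda>a b a' b'. \<Psi> (br (br a a') x) b b')"
    have "Q (\<lambda>a b a' b'. \<Psi> (br a x) (br a' b) b') = - Q (\<lambda>a b a' b'. \<Psi> (br b x) (br a' a) b')"
      "Q (\<lambda>a b a' b'. \<Psi> (br a x) (br b a') b') = - Q (\<lambda>a b a' b'. \<Psi> (br b x) (br a a') b')"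
      by (rule Q_outer, intro bilinear_form_on_compose[OF \<Psi>1] linear_intros x, assumption+)+
    moreover have "Q (\<lambda>a b a' b'. \<Psi> (br b x) (br a' a) b') = - Z'"
      "Q (\<lambda>a b a' b'. \<Psi> (br b x) (br a a') b') = - Z"
      unfolding Z_def Z'_def Q_minus[symmetric] by (subst skew(1), simp)+
    ultimately have t1: "Q (\<lambda>a b a' b'. \<Psi> (br a x) (br a' b) b') = Z'"
      and t2: "Q (\<lambda>a b a' b'. \<Psi> (br a x) (br b a') b') = Z"
      by simp_all
    have t3: "Q (\<lambda>a b a' b'. \<Psi> (br a x) a' (br b' b)) = Z'"
    proof -
      have "Q (\<lambda>a b a' b'. \<Psi> (br a x) a' (br b' b)) = - Q (\<lambda>a b a' b'. \<Psi> (br b x) a' (br b' a))"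
        by (rule Q_outer) (intro bilinear_form_on_compose[OF \<Psi>2] linear_intros x)
      also have "\<dots> = Q (\<lambda>a b a' b'. \<Psi> (br b x) b' (br a' a))"
        by (subst Q_inner)
          (auto intro!: bilinear_form_on_compose[OF \<Psi>3] linear_intros x closed)
      also have "\<dots> = Z'"
        unfolding Z'_def by (rule Q_cong) (metis skew minus_minus)
      finally show ?thesis .
    qed
    have "trilinear_form_on scale B (\<lambda>p q s. \<Psi> (br p x) q s)"
      by (rule trilinear_form_on_compose[OF \<Psi>]) (intro linear_intros x)+
    with yang_baxter have "tensor_eval (yang_baxter_tensor br r) (\<lambda>(p, q, s). \<Psi> (br p x) q s) = 0"
      unfolding eq_tensor3_iff by fastforce
    then have "Q (\<lambda>a b a' b'. \<Psi> (br (br a a') x) b b' + \<Psi> (br a x) (br a' b - br b a') b' -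
        \<Psi> (br a x) a' (br b' b)) = 0"
      by (simp add: yang_baxter_tensor_def case_prod_unfold Q_def contract_def)
    moreover have "Q (\<lambda>a b a' b'. \<Psi> (br a x) (br a' b - br b a') b') =
        Q (\<lambda>a b a' b'. \<Psi> (br a x) (br a' b) b') - Q (\<lambda>a b a' b'. \<Psi> (br a x) (br b a') b')"
      unfolding Q_diff[symmetric] using x
      by (intro Q_cong bilinear_form_on_minus(2)[OF subspace \<Psi>1] closed)
    ultimately have YZ: "Y = Z"
      by (simp add: Q_diff Q_add t1 t2 t3 Y_def)
    \<comment> \<open>Exchanging the two copies of \<open>r\<close> turns \<open>E\<close> into minus its counterpart with \<open>a\<close>
      and \<open>a'\<close> exchanged, so \<open>2 E\<close> is the difference to which the left Alia identity applies.\<close>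
    define E where "E = Q (\<lambda>a b a' b'. \<Psi> (br (D x a) a') b' b)"
    have "E = Q (\<lambda>a b a' b'. \<Psi> (br (D x a') a) b b')"
      unfolding E_def by (rule Q_swap)
    also have "\<dots> = - Q (\<lambda>a b a' b'. \<Psi> (br (D x a') a) b' b)"
      unfolding Q_minus[symmetric] by (subst skew(2)) simp
    finally have "E + E = E - Q (\<lambda>a b a' b'. \<Psi> (br (D x a') a) b' b)"
      by simp
    also have "\<dots> = Q (\<lambda>a b a' b'. \<Psi> (br (br a a') x) b' b) - Q (\<lambda>a b a' b'. \<Psi> (br (br a' a) x) b' b)"
      unfolding E_def Q_diff[symmetric]
    proof (rule Q_cong)
      fix a b a' b' assume B: "a \<in> B" "b \<in> B" "a' \<in> B" "b' \<in> B"
      have "br (D x a) a' - br (D x a') a = br (br a a') x - br (br a' a) x"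
        using alia[OF B(1) x B(3)] B x by (simp add: bracket_minus closed algebra_simps)
      then show "\<Psi> (br (D x a) a') b' b - \<Psi> (br (D x a') a) b' b =
          \<Psi> (br (br a a') x) b' b - \<Psi> (br (br a' a) x) b' b"
        using B x by (simp only: bilinear_form_on_minus(1)[OF subspace \<Psi>1, symmetric] closed commutator_closed)
    qed
    also have "Q (\<lambda>a b a' b'. \<Psi> (br (br a' a) x) b' b) = Y"
      unfolding Y_def by (rule Q_swap)
    also have "Q (\<lambda>a b a' b'. \<Psi> (br (br a a') x) b' b) = - Y"
      unfolding Y_def Q_minus[symmetric] by (subst skew(2)) simp
    finally have "2 * E = 2 * (- Y)" by simp
    then have "E = - Y" by simp
    moreover have "Q (\<lambda>a b a' b'. \<Psi> (br a a') b' (br b x)) = - Z"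
      unfolding Z_def Q_minus[symmetric] by (subst skew(2)) simp
    ultimately show ?thesis using YZ by (simp add: E_def)
  qed
  finally show "tensor_eval (iterated_coproduct \<Delta> x (\<lambda>p q s. ten3 q p s + ten3 p s q + ten3 s q p))
        (\<lambda>(x, y, z). \<Phi> x y z) =
      tensor_eval (iterated_coproduct \<Delta> x (\<lambda>p q s. ten3 p q s + ten3 q s p + ten3 s p q))
        (\<lambda>(x, y, z). \<Phi> x y z)"
    by simp
qed

text \<open>
  Once all operators sit in one factor, an identity between contractions is an identity between
  operators on \<open>B\<close>; this lemma and the next one make that passage.
\<close>

lemma contract_first:
  assumes F: "bilinear_form_on scale B F"
    and "linear_on scale B f1" "linear_on scale B f2" "linear_on scale B g1" "linear_on scale B g2"
    and eq: "\<And>z. z \<in> B \<Longrightarrow> f1 z + f2 z = g1 z + g2 z"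
  shows "contract (\<lambda>a b. F (f1 a) b) + contract (\<lambda>a b. F (f2 a) b) =
    contract (\<lambda>a b. F (g1 a) b) + contract (\<lambda>a b. F (g2 a) b)"
  unfolding contract_add[symmetric] using assms(2-5)
  by (intro contract_cong) (simp add: linear_onD eq bilinear_form_onD(1)[OF F, symmetric])

lemma contract_second:
  assumes F: "bilinear_form_on scale B F"
    and "linear_on scale B f1" "linear_on scale B f2" "linear_on scale B g1" "linear_on scale B g2"
    and eq: "\<And>z. z \<in> B \<Longrightarrow> f1 z + f2 z = g1 z + g2 z"
  shows "contract (\<lambda>a b. F a (f1 b)) + contract (\<lambda>a b. F a (f2 b)) =
    contract (\<lambda>a b. F a (g1 b)) + contract (\<lambda>a b. F a (g2 b))"
  unfolding contract_add[symmetric] using assms(2-5)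
  by (intro contract_cong) (simp add: linear_onD eq bilinear_form_onD(2)[OF F, symmetric])

end

section \<open>Nijenhuis coboundary bialgebras\<close>

locale nijenhuis_antisymmetric_tensor_algebra =
  antisymmetric_tensor_algebra scale B br r + nijenhuis_left_alia_algebra scale B br M
  for scale :: "'k::field_char_0 \<Rightarrow> 'b::ab_group_add \<Rightarrow> 'b" and B br r M +
  fixes P :: "'b \<Rightarrow> 'b"
  assumes linear_P: "linear_on scale B P"
    and admissible: "adjoint_admissible B br M P"
    and invariant: "eq_tensor2 scale B (map_tensor P id r - map_tensor id M r) 0"
begin

lemmas P_minus = linear_on_minus[OF subspace linear_P]
lemmas M_minus = linear_on_minus[OF subspace linear_N]
lemmas operator_intros = linear_intros linear_on_compose[OF linear_P] linear_on_compose[OF linear_N]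

lemma admissible_at:
  assumes "z \<in> B" "x \<in> B"
  shows "P (br (M z) x) + br z (P (P x)) = P (br z (P x)) + br (M z) (P x)"
    and "P (br z (M x)) + br (P (P z)) x = P (br (P z) x) + br (P z) (M x)"
  using admissible assms by (auto simp: adjoint_admissible_def)

lemma diff_add_diff_eq:
  fixes a1 :: 'b
  assumes "a1 + b1 = c1 + d1" "a2 + b2 = c2 + d2"
  shows "(a1 - a2) + (b1 - b2) = (c1 - c2) + (d1 - d2)"
  using assms by (metis add_diff_add)

lemma first_to_second:
  assumes "bilinear_form_on scale B F"
  shows "contract (\<lambda>a b. F (P a) b) = contract (\<lambda>a b. F a (M b))"
  using invariant assms unfolding eq_tensor2_iff
  by (simp add: contract_def case_prod_unfold)

text \<open>
  This is the flip of the invariance of \<open>r\<close>, available because \<open>r\<close> is antisymmetric.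
\<close>

lemma second_to_first:
  assumes F: "bilinear_form_on scale B F"
  shows "contract (\<lambda>a b. F a (P b)) = contract (\<lambda>a b. F (M a) b)"
proof -
  have "contract (\<lambda>a b. F a (P b)) = - contract (\<lambda>a b. F b (P a))"
    by (rule contract_antisymmetric) (intro bilinear_form_on_compose[OF F] operator_intros)
  also have "\<dots> = - contract (\<lambda>a b. F (M b) a)"
    using first_to_second[of "\<lambda>a b. F b a"] bilinear_form_on_compose_flip[OF F linear_on_id linear_on_id]
    by simp
  also have "\<dots> = contract (\<lambda>a b. F (M a) b)"
    using contract_antisymmetric[of "\<lambda>a b. F (M a) b"]
      bilinear_form_on_compose[OF F linear_N linear_on_id] by simp
  finally show ?thesis .
qed

text \<open>
  The two conditions of adjoint admissibility and the Nijenhuis identity treat left and right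
  multiplication alike, so their differences hold for the commutator \<open>D\<close>, which is what acts on the
  first factor of \<open>\<Delta>\<close>.
\<close>

lemma commutator_admissible:
  assumes x: "x \<in> B" and z: "z \<in> B"
  shows "P (D x (M z)) + D (P (P x)) z = P (D (P x) z) + D (P x) (M z)"
    and "P (D (M x) z) + D x (P (P z)) = P (D x (P z)) + D (M x) (P z)"
    and "D (M x) (M z) + M (M (D x z)) = M (D x (M z)) + M (D (M x) z)"
proof -
  note in_B = x z closed linear_onD(1)[OF linear_P] linear_onD(1)[OF linear_N]
  have "(P (br (M z) x) - P (br x (M z))) + (br z (P (P x)) - br (P (P x)) z) =
      (P (br z (P x)) - P (br (P x) z)) + (br (M z) (P x) - br (P x) (M z))"
    by (intro diff_add_diff_eq admissible_at x z)
  then show "P (D x (M z)) + D (P (P x)) z = P (D (P x) z) + D (P x) (M z)"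
    by (simp only: P_minus in_B)
  have "(P (br z (M x)) - P (br (M x) z)) + (br (P (P z)) x - br x (P (P z))) =
      (P (br (P z) x) - P (br x (P z))) + (br (P z) (M x) - br (M x) (P z))"
    by (intro diff_add_diff_eq admissible_at x z)
  then show "P (D (M x) z) + D x (P (P z)) = P (D x (P z)) + D (M x) (P z)"
    by (simp only: P_minus in_B)
  have "(br (M z) (M x) - br (M x) (M z)) + (M (M (br z x)) - M (M (br x z))) =
      (M (br (M z) x) - M (br x (M z))) + (M (br z (M x)) - M (br (M x) z))"
    using nijenhuis[OF z x] nijenhuis[OF x z]
    by (intro diff_add_diff_eq) (simp_all add: linear_onD(2)[OF linear_N] in_B add.commute)
  then show "D (M x) (M z) + M (M (D x z)) = M (D x (M z)) + M (D (M x) z)"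
    by (simp only: M_minus in_B)
qed

lemma move_P:
  assumes F: "bilinear_form_on scale B F" and f: "linear_on scale B f" and g: "linear_on scale B g"
  shows "contract (\<lambda>a b. F (f (P a)) (g b)) = contract (\<lambda>a b. F (f a) (g (M b)))"
    and "contract (\<lambda>a b. F (f a) (g (P b))) = contract (\<lambda>a b. F (f (M a)) (g b))"
  using first_to_second[OF bilinear_form_on_compose[OF F f g]]
    second_to_first[OF bilinear_form_on_compose[OF F f g]] .

text \<open>
  In this and the next two lemmas the terms of \<open>\<Delta>\<close> with \<open>D\<close> are brought to the first factor and
  those with a right multiplication to the second, using \<open>(P \<otimes> id) r = (id \<otimes> M) r\<close> and its flip.
  In \<open>coproduct_PP\<close> both factors then ask for adjoint admissibility.
\<close>

lemma coproduct_PP: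
  assumes x: "x \<in> B"
  shows "eq_tensor2 scale B (map_tensor P P (\<Delta> x) + \<Delta> (P (P x)))
    (map_tensor P id (\<Delta> (P x)) + map_tensor id P (\<Delta> (P x)))"
  unfolding eq_tensor2_iff
proof (intro allI impI)
  fix F assume F: "bilinear_form_on scale B F"
  note Px = linear_onD(1)[OF linear_P x] and Mx = linear_onD(1)[OF linear_N x]
  note PPx = linear_onD(1)[OF linear_P Px]
  have "contract (\<lambda>a b. F (P (D x a)) (P b)) = contract (\<lambda>a b. F (P (D x (M a))) b)"
    by (rule move_P(2)[OF F, where f = "\<lambda>a. P (D x a)" and g = "\<lambda>b. b"])
      (intro operator_intros x Px Mx linear_N)+
  moreover have "contract (\<lambda>a b. F (D (P x) a) (P b)) = contract (\<lambda>a b. F (D (P x) (M a)) b)"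
    by (rule move_P(2)[OF F, where f = "D (P x)" and g = "\<lambda>b. b"])
      (intro operator_intros x Px Mx linear_N)+
  moreover have "contract (\<lambda>a b. F (P a) (P (br b x))) = contract (\<lambda>a b. F a (P (br (M b) x)))"
    by (rule move_P(1)[OF F, where f = "\<lambda>a. a" and g = "\<lambda>b. P (br b x)"])
      (intro operator_intros x Px Mx linear_N)+
  moreover have "contract (\<lambda>a b. F (P a) (br b (P x))) = contract (\<lambda>a b. F a (br (M b) (P x)))"
    by (rule move_P(1)[OF F, where f = "\<lambda>a. a" and g = "\<lambda>b. br b (P x)"])
      (intro operator_intros x Px Mx linear_N)+
  moreover have "contract (\<lambda>a b. F (P (D x (M a))) b) + contract (\<lambda>a b. F (D (P (P x)) a) b) =
      contract (\<lambda>a b. F (P (D (P x) a)) b) + contract (\<lambda>a b. F (D (P x) (M a)) b)"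
    by (intro contract_first[OF F] operator_intros x Px PPx commutator_admissible)
  moreover have "contract (\<lambda>a b. F a (P (br (M b) x))) + contract (\<lambda>a b. F a (br b (P (P x)))) =
      contract (\<lambda>a b. F a (P (br b (P x)))) + contract (\<lambda>a b. F a (br (M b) (P x)))"
    by (intro contract_second[OF F] operator_intros x Px PPx) (rule admissible_at[OF _ x])
  ultimately show "tensor_eval (map_tensor P P (\<Delta> x) + \<Delta> (P (P x))) (\<lambda>(x, y). F x y) =
      tensor_eval (map_tensor P id (\<Delta> (P x)) + map_tensor id P (\<Delta> (P x))) (\<lambda>(x, y). F x y)"
    by (simp add: tensor_eval_coboundary contract_diff algebra_simps)
qed

text \<open>
  The first factor asks for adjoint admissibility, the second one for the Nijenhuis identity.
\<close>

lemma coproduct_PM: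
  assumes x: "x \<in> B"
  shows "eq_tensor2 scale B (map_tensor P id (\<Delta> (M x)) + map_tensor id (M \<circ> M) (\<Delta> x))
    (map_tensor P M (\<Delta> x) + map_tensor id M (\<Delta> (M x)))"
  unfolding eq_tensor2_iff
proof (intro allI impI)
  fix F assume F: "bilinear_form_on scale B F"
  note Px = linear_onD(1)[OF linear_P x] and Mx = linear_onD(1)[OF linear_N x]
  have "contract (\<lambda>a b. F (D x a) (M (M b))) = contract (\<lambda>a b. F (D x (P a)) (M b))"
    by (rule move_P(1)[OF F, where f = "D x" and g = M, symmetric])
      (intro operator_intros x Px Mx linear_N)+
  moreover have "contract (\<lambda>a b. F (D x (P a)) (M b)) = contract (\<lambda>a b. F (D x (P (P a))) b)"
    by (rule move_P(1)[OF F, where f = "\<lambda>a. D x (P a)" and g = "\<lambda>b. b", symmetric])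
      (intro operator_intros x Px Mx linear_N)+
  moreover have "contract (\<lambda>a b. F (P (D x a)) (M b)) = contract (\<lambda>a b. F (P (D x (P a))) b)"
    by (rule move_P(1)[OF F, where f = "\<lambda>a. P (D x a)" and g = "\<lambda>b. b", symmetric])
      (intro operator_intros x Px Mx linear_N)+
  moreover have "contract (\<lambda>a b. F (D (M x) a) (M b)) = contract (\<lambda>a b. F (D (M x) (P a)) b)"
    by (rule move_P(1)[OF F, where f = "D (M x)" and g = "\<lambda>b. b", symmetric])
      (intro operator_intros x Px Mx linear_N)+
  moreover have "contract (\<lambda>a b. F (P a) (br b (M x))) = contract (\<lambda>a b. F a (br (M b) (M x)))"
    by (rule move_P(1)[OF F, where f = "\<lambda>a. a" and g = "\<lambda>b. br b (M x)"])
      (intro operator_intros x Px Mx linear_N)+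
  moreover have "contract (\<lambda>a b. F (P a) (M (br b x))) = contract (\<lambda>a b. F a (M (br (M b) x)))"
    by (rule move_P(1)[OF F, where f = "\<lambda>a. a" and g = "\<lambda>b. M (br b x)"])
      (intro operator_intros x Px Mx linear_N)+
  moreover have "contract (\<lambda>a b. F (P (D (M x) a)) b) + contract (\<lambda>a b. F (D x (P (P a))) b) =
      contract (\<lambda>a b. F (P (D x (P a))) b) + contract (\<lambda>a b. F (D (M x) (P a)) b)"
    by (intro contract_first[OF F] operator_intros x Mx commutator_admissible)
  moreover have "contract (\<lambda>a b. F a (br (M b) (M x))) + contract (\<lambda>a b. F a (M (M (br b x)))) =
      contract (\<lambda>a b. F a (M (br (M b) x))) + contract (\<lambda>a b. F a (M (br b (M x))))"
    using x by (intro contract_second[OF F] operator_intros x Mx)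
      (simp add: nijenhuis closed linear_onD(1)[OF linear_N] linear_onD(2)[OF linear_N])
  ultimately show "tensor_eval (map_tensor P id (\<Delta> (M x)) + map_tensor id (M \<circ> M) (\<Delta> x))
      (\<lambda>(x, y). F x y) =
      tensor_eval (map_tensor P M (\<Delta> x) + map_tensor id M (\<Delta> (M x))) (\<lambda>(x, y). F x y)"
    by (simp add: tensor_eval_coboundary contract_diff algebra_simps)
qed

text \<open>
  Here the roles are exchanged: the Nijenhuis identity appears in the first factor and adjoint
  admissibility in the second.
\<close>

lemma coproduct_MP:
  assumes x: "x \<in> B"
  shows "eq_tensor2 scale B (map_tensor id P (\<Delta> (M x)) + map_tensor (M \<circ> M) id (\<Delta> x))
    (map_tensor M P (\<Delta> x) + map_tensor M id (\<Delta> (M x)))"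
  unfolding eq_tensor2_iff
proof (intro allI impI)
  fix F assume F: "bilinear_form_on scale B F"
  note Px = linear_onD(1)[OF linear_P x] and Mx = linear_onD(1)[OF linear_N x]
  have "contract (\<lambda>a b. F (D (M x) a) (P b)) = contract (\<lambda>a b. F (D (M x) (M a)) b)"
    by (rule move_P(2)[OF F, where f = "D (M x)" and g = "\<lambda>b. b"])
      (intro operator_intros x Px Mx linear_N)+
  moreover have "contract (\<lambda>a b. F (M (D x a)) (P b)) = contract (\<lambda>a b. F (M (D x (M a))) b)"
    by (rule move_P(2)[OF F, where f = "\<lambda>a. M (D x a)" and g = "\<lambda>b. b"])
      (intro operator_intros x Px Mx linear_N)+
  moreover have "contract (\<lambda>a b. F (M (M a)) (br b x)) = contract (\<lambda>a b. F (M a) (br (P b) x))"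
    by (rule move_P(2)[OF F, where f = M and g = "\<lambda>b. br b x", symmetric])
      (intro operator_intros x Px Mx linear_N)+
  moreover have "contract (\<lambda>a b. F (M a) (br (P b) x)) = contract (\<lambda>a b. F a (br (P (P b)) x))"
    by (rule move_P(2)[OF F, where f = "\<lambda>a. a" and g = "\<lambda>b. br (P b) x", symmetric])
      (intro operator_intros x Px Mx linear_N)+
  moreover have "contract (\<lambda>a b. F (M a) (P (br b x))) = contract (\<lambda>a b. F a (P (br (P b) x)))"
    by (rule move_P(2)[OF F, where f = "\<lambda>a. a" and g = "\<lambda>b. P (br b x)", symmetric])
      (intro operator_intros x Px Mx linear_N)+
  moreover have "contract (\<lambda>a b. F (M a) (br b (M x))) = contract (\<lambda>a b. F a (br (P b) (M x)))"
    by (rule move_P(2)[OF F, where f = "\<lambda>a. a" and g = "\<lambda>b. br b (M x)", symmetric])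
      (intro operator_intros x Px Mx linear_N)+
  moreover have "contract (\<lambda>a b. F (D (M x) (M a)) b) + contract (\<lambda>a b. F (M (M (D x a))) b) =
      contract (\<lambda>a b. F (M (D x (M a))) b) + contract (\<lambda>a b. F (M (D (M x) a)) b)"
    by (intro contract_first[OF F] operator_intros x Mx commutator_admissible)
  moreover have "contract (\<lambda>a b. F a (P (br b (M x)))) + contract (\<lambda>a b. F a (br (P (P b)) x)) =
      contract (\<lambda>a b. F a (P (br (P b) x))) + contract (\<lambda>a b. F a (br (P b) (M x)))"
    by (intro contract_second[OF F] operator_intros x Mx) (rule admissible_at[OF _ x])
  ultimately show "tensor_eval (map_tensor id P (\<Delta> (M x)) + map_tensor (M \<circ> M) id (\<Delta> x))
      (\<lambda>(x, y). F x y) =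
      tensor_eval (map_tensor M P (\<Delta> x) + map_tensor M id (\<Delta> (M x))) (\<lambda>(x, y). F x y)"
    by (simp add: tensor_eval_coboundary contract_diff algebra_simps)
qed

theorem nijenhuis_coboundary_bialgebra:
  assumes "eq_tensor3 scale B (yang_baxter_tensor br r) 0"
  shows "nijenhuis_left_alia_bialgebra scale B br \<Delta> M P"
proof unfold_locales
  fix x y c assume x: "x \<in> B" and y: "y \<in> B"
  show "eq_tensor2 scale B (\<Delta> (x + y)) (\<Delta> x + \<Delta> y)"
    unfolding eq_tensor2_iff using coboundary_linear(1) x y by simp
  show "let t = \<Delta> (br x y - br y x);
       t' = map_tensor (\<lambda>z. br z y) id (\<Delta> x) - map_tensor (\<lambda>z. br z x) id (\<Delta> y)
    in eq_tensor2 scale B (flip_tensor t - t) (flip_tensor t' - t')"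
    using x y by (rule coboundary_compatible)
next
  fix x c assume x: "x \<in> B"
  show "eq_tensor2 scale B (\<Delta> (scale c x)) (fscale c (\<Delta> x))"
    unfolding eq_tensor2_iff using coboundary_linear(2) x by simp
qed (use coboundary_coalia[OF assms] coproduct_PP coproduct_PM coproduct_MP
    subspace linear_P admissible coboundary_closed in auto)

end

section \<open>The semi-direct product with the dual representation\<close>

lemma dual_space_iff:
  assumes "vector_space scaleV"
  shows "f \<in> dual_space scaleV \<longleftrightarrow>
    (\<forall>u v. f (u + v) = f u + f v) \<and> (\<forall>c v. f (scaleV c v) = c * f v)"
  using assms vector_space_field by (auto simp: dual_space_def Vector_Spaces.linear_iff)

lemma linearD:
  assumes "Vector_Spaces.linear s1 s2 f"
  shows "f (x + y) = f x + f y" "f (s1 c x) = s2 c (f x)" "f (x - y) = f x - f y" "f (- x) = - f x"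
    "f 0 = 0"
proof -
  interpret Vector_Spaces.linear s1 s2 f by fact
  show "f (x + y) = f x + f y" "f (s1 c x) = s2 c (f x)" "f (x - y) = f x - f y" "f (- x) = - f x"
    "f 0 = 0"
    by (rule add scale diff neg zero)+
qed

lemma dual_spaceD:
  assumes "f \<in> dual_space scaleV"
  shows "f (u + v) = f u + f v" "f (scaleV c v) = c * f v" "f (u - v) = f u - f v" "f (- v) = - f v"
    "f 0 = 0"
  using assms linearD[of scaleV "(*)" f] by (simp_all add: dual_space_def)

lemma dual_space_compose:
  assumes "f \<in> dual_space scaleV" "Vector_Spaces.linear scaleV scaleV \<sigma>"
  shows "(\<lambda>v. f (\<sigma> v)) \<in> dual_space scaleV"
  using Vector_Spaces.linear_compose[OF assms(2), of "(*)" f] assms(1)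
  by (simp add: dual_space_def o_def)

locale dual_semidirect_product =
  left_alia_representation scaleA br scaleV l \<rho>
  for scaleA :: "'k::field_char_0 \<Rightarrow> 'a::ab_group_add \<Rightarrow> 'a" and br
    and scaleV :: "'k \<Rightarrow> 'v::ab_group_add \<Rightarrow> 'v" and l \<rho>
begin

definition B :: "('a \<times> ('v \<Rightarrow> 'k)) set" where "B = UNIV \<times> dual_space scaleV"

abbreviation scaleB :: "'k \<Rightarrow> 'a \<times> ('v \<Rightarrow> 'k) \<Rightarrow> 'a \<times> ('v \<Rightarrow> 'k)" where
  "scaleB \<equiv> dual_sum_scale scaleA"

definition brB :: "'a \<times> ('v \<Rightarrow> 'k) \<Rightarrow> 'a \<times> ('v \<Rightarrow> 'k) \<Rightarrow> 'a \<times> ('v \<Rightarrow> 'k)" where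
  "brB = semidirect_bracket br (dual_action l) (\<lambda>x f. dual_action l x f - dual_action \<rho> x f)"

lemma B_iff [simp]: "(x, f) \<in> B \<longleftrightarrow> f \<in> dual_space scaleV"
  by (simp add: B_def)

lemma brB_Pair:
  "brB (x, f) (y, g) = (br x y, \<lambda>v. f (\<rho> y v) - f (l y v) - g (l x v))"
  by (simp add: brB_def semidirect_bracket_def dual_action_def fun_eq_iff)

lemma scaleB_Pair: "scaleB c (x, f) = (scaleA c x, \<lambda>v. c * f v)"
  by (simp add: dual_sum_scale_def)

lemma dual_space_I:
  "(\<And>u v. f (u + v) = f u + f v) \<Longrightarrow> (\<And>c v. f (scaleV c v) = c * f v) \<Longrightarrow>
    f \<in> dual_space scaleV"
  using dual_space_iff[OF module.vector_space_axioms] by simp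

lemma vector_space_B: "vector_space scaleB"
  by unfold_locales
    (auto simp: scaleB_Pair fun_eq_iff algebra_simps algebra.scale_right_distrib
      algebra.scale_left_distrib)

text \<open>
  The left Alia identity in the semi-direct product is linear in the \<open>V\<^sup>*\<close>-components of its three
  arguments. The part containing one of them, \<open>f\<close>, is \<open>f\<close> applied to the representation identity
  on \<open>V\<close>; the second action \<open>\<ell>\<^sup>* - \<rho>\<^sup>*\<close> is what makes the reversed order of composition
  come out right.
\<close>

lemma left_alia_algebra_B: "left_alia_algebra scaleB B brB"
proof -
  interpret B: vector_space scaleB by (rule vector_space_B)
  have rep: "f (l (br x y) v) = f (l (br y x) v) + f (\<rho> x (\<rho> y v)) - f (\<rho> x (l y v))
      - f (\<rho> y (\<rho> x v)) + f (\<rho> y (l x v))"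
    if f: "f \<in> dual_space scaleV" for f x y v
  proof -
    have "l (br x y) v = l (br y x) v + (\<rho> x (\<rho> y v) - \<rho> x (l y v))
       - (\<rho> y (\<rho> x v) - \<rho> y (l x v))"
      using representation[of x y v] by (simp add: linearD[OF linear_\<rho>] algebra_simps)
    then show ?thesis by (simp add: dual_spaceD[OF f])
  qed
  show ?thesis
  proof (unfold_locales, goal_cases)
    case 1
    then show ?case
      by (auto simp: B.subspace_def B_def scaleB_Pair zero_prod_def plus_prod_def
          intro!: dual_space_I simp: dual_spaceD algebra_simps)
  next
    case (2 x y)
    then show ?case
      by (cases x; cases y) (auto simp: brB_Pair intro!: dual_space_I
          simp: dual_spaceD linearD[OF linear_l] linearD[OF linear_\<rho>] algebra_simps)
  next
    case (3 x y z)
    then show ?case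
      by (cases x; cases y; cases z) (auto simp: brB_Pair fun_eq_iff algebra.add_left l_add \<rho>_add
          dual_spaceD algebra_simps)
  next
    case (4 x y z)
    then show ?case
      by (cases x; cases y; cases z) (auto simp: brB_Pair fun_eq_iff algebra.add_right l_add \<rho>_add
          dual_spaceD algebra_simps)
  next
    case (5 x y c)
    then show ?case
      by (cases x; cases y) (auto simp: brB_Pair scaleB_Pair fun_eq_iff algebra.scale_left l_scale \<rho>_scale
          dual_spaceD algebra_simps)
  next
    case (6 x y c)
    then show ?case
      by (cases x; cases y) (auto simp: brB_Pair scaleB_Pair fun_eq_iff algebra.scale_right l_scale \<rho>_scale
          dual_spaceD algebra_simps)
  next
    case (7 x y z)
    obtain x' f y' g z' h where eq: "x = (x', f)" "y = (y', g)" "z = (z', h)"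
      by (metis surj_pair)
    with 7 have fgh: "f \<in> dual_space scaleV" "g \<in> dual_space scaleV" "h \<in> dual_space scaleV"
      by auto
    show ?case
      unfolding eq brB_Pair
      using algebra.alia[of x' y' z']
      by (simp add: fun_eq_iff rep[OF fgh(1), of y' z'] rep[OF fgh(2), of z' x']
          rep[OF fgh(3), of x' y'])
  qed
qed

lemma linear_on_map_prod_dual:
  assumes N: "Vector_Spaces.linear scaleA scaleA N" and \<beta>: "Vector_Spaces.linear scaleV scaleV \<beta>"
  shows "linear_on scaleB B (map_prod N (dual_map \<beta>))"
  using dual_space_compose[OF _ \<beta>]
  by (auto simp: linear_on_def B_def scaleB_Pair dual_map_def o_def fun_eq_iff linearD[OF N])

text \<open>
  On \<open>V\<^sup>*\<close> the Nijenhuis identity for \<open>N + \<beta>\<^sup>*\<close> is the transpose of the admissibility of \<open>\<beta>\<close>.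
\<close>

lemma nijenhuis_B:
  assumes N: "nijenhuis_left_alia_algebra scaleA UNIV br N"
    and \<beta>: "Vector_Spaces.linear scaleV scaleV \<beta>"
    and admissible: "admissible_operator N l \<rho> \<beta>"
  shows "nijenhuis_left_alia_algebra scaleB B brB (map_prod N (dual_map \<beta>))"
proof -
  interpret B: left_alia_algebra scaleB B brB by (rule left_alia_algebra_B)
  interpret N: nijenhuis_left_alia_algebra scaleA UNIV br N by fact
  have "Vector_Spaces.linear scaleA scaleA N"
    using N.linear_N algebra.vector_space_axioms
    by (simp add: linear_on_def Vector_Spaces.linear_iff)
  note linear = linear_on_map_prod_dual[OF this \<beta>]
  have admissible_at: "f (\<beta> (\<sigma> (N x) v)) = f (\<sigma> (N x) (\<beta> v)) + f (\<beta> (\<sigma> x (\<beta> v))) - f (\<sigma> x (\<beta> (\<beta> v)))"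
    if "f \<in> dual_space scaleV" "\<sigma> \<in> {l, \<rho>}" for f \<sigma> x v
  proof -
    have "\<beta> (\<sigma> (N x) v) = \<sigma> (N x) (\<beta> v) + \<beta> (\<sigma> x (\<beta> v)) - \<sigma> x (\<beta> (\<beta> v))"
      using admissible that(2) unfolding admissible_operator_def
      by (auto simp: eq_diff_eq)
    then show ?thesis by (simp add: dual_spaceD[OF that(1)])
  qed
  show ?thesis
  proof (unfold_locales, rule linear)
    fix x y assume "x \<in> B" "y \<in> B"
    then obtain x' f y' g where eq: "x = (x', f)" "y = (y', g)"
      and fg: "f \<in> dual_space scaleV" "g \<in> dual_space scaleV"
      by (cases x; cases y) auto
    show "brB (map_prod N (dual_map \<beta>) x) (map_prod N (dual_map \<beta>) y) +
        map_prod N (dual_map \<beta>) (map_prod N (dual_map \<beta>) (brB x y)) =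
      map_prod N (dual_map \<beta>)
        (brB (map_prod N (dual_map \<beta>) x) y + brB x (map_prod N (dual_map \<beta>) y))"
      unfolding eq using N.nijenhuis[of x' y']
      by (simp add: brB_Pair dual_map_def o_def fun_eq_iff
          admissible_at[OF fg(1), of l] admissible_at[OF fg(1), of \<rho>] admissible_at[OF fg(2), of l])
  qed
qed

text \<open>
  In each of the two conditions one of the functionals only meets \<open>N\<close> and \<open>\<alpha>\<close>, and its part is the
  transpose of the representation condition on \<open>\<alpha>\<close>; the other one only meets \<open>S\<close>, \<open>\<alpha>\<close> and
  \<open>\<beta>\<close>, and its part is the transpose of the conditions relating these maps.
\<close>

lemma adjoint_admissible_B:
  assumes S: "adjoint_admissible UNIV br N S"
    and \<alpha>: "nijenhuis_left_alia_representation scaleA br N scaleV l \<rho> \<alpha>"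
    and \<rho>_S: "\<And>x v. \<beta> (\<rho> x (\<alpha> v)) + \<rho> (S (S x)) v = \<rho> (S x) (\<alpha> v) + \<beta> (\<rho> (S x) v)"
    and l_S: "\<And>x v. \<beta> (l x (\<alpha> v)) + l (S (S x)) v = l (S x) (\<alpha> v) + \<beta> (l (S x) v)"
  shows "adjoint_admissible B brB (map_prod N (dual_map \<beta>)) (map_prod S (dual_map \<alpha>))"
  unfolding adjoint_admissible_def
proof (intro ballI)
  interpret \<alpha>: nijenhuis_left_alia_representation scaleA br N scaleV l \<rho> \<alpha> by fact
  fix x y assume "x \<in> B" "y \<in> B"
  then obtain x' f y' g where eq: "x = (x', f)" "y = (y', g)"
    and fg: "f \<in> dual_space scaleV" "g \<in> dual_space scaleV"
    by (cases x; cases y) auto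
  have S': "f (\<sigma> (S (S x)) v) = f (\<sigma> (S x) (\<alpha> v)) + f (\<beta> (\<sigma> (S x) v)) - f (\<beta> (\<sigma> x (\<alpha> v)))"
    if "f \<in> dual_space scaleV" "\<sigma> \<in> {l, \<rho>}" for f \<sigma> x v
  proof -
    have "\<sigma> (S (S x)) v = \<sigma> (S x) (\<alpha> v) + \<beta> (\<sigma> (S x) v) - \<beta> (\<sigma> x (\<alpha> v))"
      using \<rho>_S[of x v] l_S[of x v] that(2) by (auto simp: eq_diff_eq add.commute)
    then show ?thesis by (simp add: dual_spaceD[OF that(1)])
  qed
  have N': "f (\<alpha> (\<alpha> (\<sigma> x v))) = f (\<alpha> (\<sigma> (N x) v)) + f (\<alpha> (\<sigma> x (\<alpha> v))) - f (\<sigma> (N x) (\<alpha> v))"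
    if "f \<in> dual_space scaleV" "\<sigma> \<in> {l, \<rho>}" for f \<sigma> x v
  proof -
    have "\<alpha> (\<alpha> (\<sigma> x v)) = \<alpha> (\<sigma> (N x) v) + \<alpha> (\<sigma> x (\<alpha> v)) - \<sigma> (N x) (\<alpha> v)"
      using \<alpha>.l_\<alpha>[of x v] \<alpha>.\<rho>_\<alpha>[of x v] that(2) by (auto simp: eq_diff_eq add.commute)
    then show ?thesis by (simp add: dual_spaceD[OF that(1)])
  qed
  show "map_prod S (dual_map \<alpha>) (brB (map_prod N (dual_map \<beta>) x) y) +
      brB x (map_prod S (dual_map \<alpha>) (map_prod S (dual_map \<alpha>) y)) =
      map_prod S (dual_map \<alpha>) (brB x (map_prod S (dual_map \<alpha>) y)) +
      brB (map_prod N (dual_map \<beta>) x) (map_prod S (dual_map \<alpha>) y) \<and>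
      map_prod S (dual_map \<alpha>) (brB x (map_prod N (dual_map \<beta>) y)) +
      brB (map_prod S (dual_map \<alpha>) (map_prod S (dual_map \<alpha>) x)) y =
      map_prod S (dual_map \<alpha>) (brB (map_prod S (dual_map \<alpha>) x) y) +
      brB (map_prod S (dual_map \<alpha>) x) (map_prod N (dual_map \<beta>) y)"
    unfolding eq using S
    by (simp add: adjoint_admissible_def brB_Pair dual_map_def o_def fun_eq_iff
        S'[OF fg(1), of l] S'[OF fg(1), of \<rho>] S'[OF fg(2), of l]
        N'[OF fg(1), of l] N'[OF fg(1), of \<rho>] N'[OF fg(2), of l])
qed

end

section \<open>The tensor of a linear map in terms of a dual basis\<close>

context finite_dimensional_vector_space
begin

abbreviation coord :: "'b \<Rightarrow> 'b \<Rightarrow> 'a" where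
  "coord e v \<equiv> representation Basis v e"

lemma coord_in_dual_space: "coord e \<in> dual_space scale"
  by (simp add: dual_space_iff vector_space_axioms representation_add representation_scale
      independent_Basis span_Basis)

lemma sum_coord: "(\<Sum>e\<in>Basis. scale (coord e v) e) = v"
  by (intro sum_representation_eq) (simp_all add: independent_Basis span_Basis finite_Basis)

lemma linear_expansion:
  assumes "Vector_Spaces.linear scale s2 T"
  shows "T u = (\<Sum>e\<in>Basis. s2 (coord e u) (T e))"
proof -
  interpret T: Vector_Spaces.linear scale s2 T by fact
  have "T u = T (\<Sum>e\<in>Basis. scale (coord e u) e)" by (simp only: sum_coord)
  then show ?thesis by (simp add: T.sum T.scale)
qed

end

lemma (in vector_space) linear_form_on_sum:
  assumes "subspace B" "linear_form_on scale B g" "\<And>i. i \<in> X \<Longrightarrow> x i \<in> B"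
  shows "g (\<Sum>i\<in>X. scale (c i) (x i)) = (\<Sum>i\<in>X. c i * g (x i))"
  using assms(3)
proof (induction X rule: infinite_finite_induct)
  case empty
  then show ?case using linear_form_on_minus[OF assms(1,2), of 0 0] subspace_0[OF assms(1)] by simp
next
  case (insert i X)
  then show ?case
    by (simp add: linear_form_onD[OF assms(2)] subspace_sum subspace_scale assms(1))
next
  case (infinite X)
  then show ?case using linear_form_on_minus[OF assms(1,2), of 0 0] subspace_0[OF assms(1)] by simp
qed

lemma (in vector_space) dual_separates_points:
  assumes "\<And>g. g \<in> dual_space scale \<Longrightarrow> g a = 0"
  shows "a = 0"
proof (rule ccontr)
  assume "a \<noteq> 0"
  then have "a \<notin> span {}" by simp
  then obtain g where "Vector_Spaces.linear scale (*) g" "g a = 1"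
    "\<And>x. x \<in> span {} \<Longrightarrow> g x = 0"
    by (rule separating_form) (rule that)
  with assms[of g] show False by (simp add: dual_space_def)
qed

text \<open>
  The pairing with functionals determines \<open>T\<close> because the dual of \<open>A\<close> separates the points of
  \<open>A\<close>, in any dimension.
\<close>

lemma represents_map_sum:
  assumes A: "vector_space scaleA" and t: "represents_map scaleA scaleV T t"
  shows "T u = (\<Sum>p\<in>Poly_Mapping.keys t. scaleA (Poly_Mapping.lookup t p * fst p u) (snd p))"
proof -
  interpret A: vector_space scaleA by fact
  let ?s = "\<Sum>p\<in>Poly_Mapping.keys t. scaleA (Poly_Mapping.lookup t p * fst p u) (snd p)"
  have "T u - ?s = 0"
  proof (rule A.dual_separates_points)
    fix g assume g: "g \<in> dual_space scaleA"
    interpret g: Vector_Spaces.linear scaleA "(*)" g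
      using g by (simp add: dual_space_def)
    have "g (T u) = tensor_pairing t u g"
      using t g by (simp add: represents_map_def)
    also have "\<dots> = g ?s"
      unfolding tensor_pairing_def g.sum g.scale by (simp only: mult.assoc)
    finally show "g (T u - ?s) = 0"
      by (simp only: g.diff diff_self)
  qed
  then show ?thesis by (simp only: right_minus_eq)
qed

lemma sum_fun_apply: "(\<Sum>i\<in>X. F i) v = (\<Sum>i\<in>X. F i v)" for F :: "'i \<Rightarrow> 'v \<Rightarrow> 'k::comm_monoid_add"
  by (induction X rule: infinite_finite_induct) auto

locale operator_tensor =
  dual_semidirect_product scaleA br scaleV l \<rho> + V: finite_dimensional_vector_space scaleV Basis
  for scaleA :: "'k::field_char_0 \<Rightarrow> 'a::ab_group_add \<Rightarrow> 'a" and br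
    and scaleV :: "'k \<Rightarrow> 'v::ab_group_add \<Rightarrow> 'v" and l \<rho> and Basis +
  fixes T :: "'v \<Rightarrow> 'a" and Tsharp :: "('v \<Rightarrow> 'k) \<times> 'a \<Rightarrow>\<^sub>0 'k"
  assumes linear_T: "Vector_Spaces.linear scaleV scaleA T"
    and represents: "represents_map scaleA scaleV T Tsharp"
begin

sublocale B: left_alia_algebra scaleB B brB
  by (rule left_alia_algebra_B)

definition r :: "('a \<times> ('v \<Rightarrow> 'k)) \<times> ('a \<times> ('v \<Rightarrow> 'k)) \<Rightarrow>\<^sub>0 'k" where
  "r = include_tensor Tsharp - flip_tensor (include_tensor Tsharp)"

text \<open>
  The dual basis vector \<open>e\<^sup>*\<close> and the vector \<open>T u\<close>, as elements of \<open>A \<oplus> V\<^sup>*\<close>.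
\<close>

definition \<iota> :: "'v \<Rightarrow> 'a \<times> ('v \<Rightarrow> 'k)" where "\<iota> e = (0, V.coord e)"

definition \<theta> :: "'v \<Rightarrow> 'a \<times> ('v \<Rightarrow> 'k)" where "\<theta> u = (T u, 0)"

lemma zero_dual: "0 \<in> dual_space scaleV" "(\<lambda>v. 0) \<in> dual_space scaleV"
  by (auto intro!: dual_space_I)

lemma \<iota>_in [simp]: "\<iota> e \<in> B" and \<theta>_in [simp]: "\<theta> u \<in> B"
  by (simp_all add: \<iota>_def \<theta>_def V.coord_in_dual_space zero_dual)

lemma Tsharp_in: "Tsharp \<in> tensors2 (dual_space scaleV) UNIV"
  using represents by (simp add: represents_map_def)

lemma include_Tsharp_in: "include_tensor Tsharp \<in> tensors2 B B"
  unfolding include_tensor_def map_tensor_def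
  using Tsharp_in by (intro tensors2_lext) (auto simp: tensors2_def ten2_def zero_dual)

lemma r_in_B: "r \<in> tensors2 B B"
  unfolding r_def flip_tensor_def
  using include_Tsharp_in
  by (intro tensors2_diff tensors2_lext) (auto simp: tensors2_def ten2_def)

lemma r_antisymmetric: "antisymmetric_tensor scaleB B r"
  unfolding antisymmetric_tensor_def eq_tensor2_iff r_def
  by (simp add: case_prod_unfold)

sublocale r: antisymmetric_tensor_algebra scaleB B brB r
  by unfold_locales (rule r_in_B r_antisymmetric)+

lemma dual_vector_expansion:
  assumes "f \<in> dual_space scaleV"
  shows "(0, f) = (\<Sum>e\<in>Basis. scaleB (f e) (\<iota> e))"
proof -
  have "(\<Sum>e\<in>Basis. f e * V.coord e v) = f v" for v
    using V.linear_expansion[of "(*)" f v, symmetric] assms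
    by (simp add: dual_space_def mult.commute)
  then have "snd (\<Sum>e\<in>Basis. scaleB (f e) (\<iota> e)) = f"
    by (intro ext) (simp only: snd_sum sum_fun_apply \<iota>_def scaleB_Pair snd_conv)
  moreover have "fst (\<Sum>e\<in>Basis. scaleB (f e) (\<iota> e)) = 0"
    by (simp add: fst_sum \<iota>_def scaleB_Pair)
  ultimately show ?thesis
    by (intro prod_eqI) simp_all
qed

lemma \<theta>_expansion:
  "\<theta> u = (\<Sum>p\<in>Poly_Mapping.keys Tsharp. scaleB (Poly_Mapping.lookup Tsharp p * fst p u) (snd p, 0))"
  using represents_map_sum[OF algebra.vector_space_axioms represents, of u]
  by (intro prod_eqI) (simp_all add: \<theta>_def fst_sum snd_sum scaleB_Pair fun_eq_iff sum_fun_apply)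

lemma \<theta>_compose_expansion:
  assumes "Vector_Spaces.linear scaleV scaleV \<sigma>"
  shows "\<theta> (\<sigma> u) = (\<Sum>e\<in>Basis. scaleB (V.coord e (\<sigma> u)) (\<theta> e))"
  using V.linear_expansion[OF linear_T, of "\<sigma> u"]
  by (intro prod_eqI) (simp_all add: \<theta>_def fst_sum snd_sum scaleB_Pair fun_eq_iff sum_fun_apply)

text \<open>
  Expanding the functionals in a representative of \<open>T\<^sub>\<sharp>\<close> in the dual basis and collecting the
  coefficients of \<open>e\<^sup>*\<close> leaves \<open>T e\<close> in the other factor: \<open>T\<^sub>\<sharp> = \<Sum> e\<^sup>* \<otimes> T e\<close>.
\<close>

lemma tensor_eval_Tsharp:
  assumes F: "bilinear_form_on scaleB B F"
  shows "tensor_eval Tsharp (\<lambda>(f, a). F (0, f) (a, 0)) = (\<Sum>e\<in>Basis. F (\<iota> e) (\<theta> e))"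
proof -
  let ?K = "Poly_Mapping.keys Tsharp" and ?c = "Poly_Mapping.lookup Tsharp"
  have F1: "linear_form_on scaleB B (\<lambda>x. F x y)" and F2: "linear_form_on scaleB B (F y)"
    if "y \<in> B" for y
    using F that by (auto simp: bilinear_form_on_def)
  have "F (0, fst p) (snd p, 0) = (\<Sum>e\<in>Basis. fst p e * F (\<iota> e) (snd p, 0))" if "p \<in> ?K" for p
  proof -
    have "fst p \<in> dual_space scaleV" using Tsharp_in that by (auto simp: tensors2_def)
    from dual_vector_expansion[OF this] show ?thesis
      using B.linear_form_on_sum[OF B.subspace F1, of "(snd p, 0)" Basis \<iota> "fst p"]
      by (simp add: zero_dual)
  qed
  then have "tensor_eval Tsharp (\<lambda>(f, a). F (0, f) (a, 0)) =
      (\<Sum>p\<in>?K. \<Sum>e\<in>Basis. ?c p * (fst p e * F (\<iota> e) (snd p, 0)))"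
    by (simp add: tensor_eval_def case_prod_unfold sum_distrib_left)
  also have "\<dots> = (\<Sum>e\<in>Basis. \<Sum>p\<in>?K. (?c p * fst p e) * F (\<iota> e) (snd p, 0))"
    by (subst sum.swap) (simp add: mult.assoc)
  also have "\<dots> = (\<Sum>e\<in>Basis. F (\<iota> e) (\<theta> e))"
    unfolding \<theta>_expansion
    by (intro sum.cong refl B.linear_form_on_sum[OF B.subspace F2, symmetric])
      (simp_all add: zero_dual)
  finally show ?thesis .
qed

lemma contract_r:
  assumes F: "bilinear_form_on scaleB B F"
  shows "r.contract F = (\<Sum>e\<in>Basis. F (\<iota> e) (\<theta> e) - F (\<theta> e) (\<iota> e))"
  using tensor_eval_Tsharp[OF F]
    tensor_eval_Tsharp[OF bilinear_form_on_compose_flip[OF F linear_on_id linear_on_id]]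
  unfolding r.contract_def
  by (simp add: r_def include_tensor_def case_prod_unfold sum_subtractf)

text \<open>
  Both sides expand to \<open>\<Sum> d\<^sup>*(\<sigma> e) F(e\<^sup>*, T d)\<close> over pairs of basis vectors.
\<close>

lemma transpose_contraction:
  assumes F: "bilinear_form_on scaleB B F" and \<sigma>: "Vector_Spaces.linear scaleV scaleV \<sigma>"
  shows "(\<Sum>e\<in>Basis. F (0, \<lambda>v. V.coord e (\<sigma> v)) (\<theta> e)) = (\<Sum>e\<in>Basis. F (\<iota> e) (\<theta> (\<sigma> e)))"
proof -
  have F1: "linear_form_on scaleB B (\<lambda>x. F x y)" and F2: "linear_form_on scaleB B (F y)"
    if "y \<in> B" for y
    using F that by (auto simp: bilinear_form_on_def)
  have "F (0, \<lambda>v. V.coord e (\<sigma> v)) (\<theta> e) = (\<Sum>d\<in>Basis. V.coord e (\<sigma> d) * F (\<iota> d) (\<theta> e))" for e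
    unfolding dual_vector_expansion[OF dual_space_compose[OF V.coord_in_dual_space \<sigma>]]
    by (rule B.linear_form_on_sum[OF B.subspace F1]) simp_all
  then have "(\<Sum>e\<in>Basis. F (0, \<lambda>v. V.coord e (\<sigma> v)) (\<theta> e)) =
      (\<Sum>d\<in>Basis. \<Sum>e\<in>Basis. V.coord e (\<sigma> d) * F (\<iota> d) (\<theta> e))"
    by (simp only:) (rule sum.swap)
  also have "\<dots> = (\<Sum>d\<in>Basis. F (\<iota> d) (\<theta> (\<sigma> d)))"
    unfolding \<theta>_compose_expansion[OF \<sigma>]
    by (intro sum.cong refl B.linear_form_on_sum[OF B.subspace F2, symmetric]) simp_all
  finally show ?thesis .
qed

section \<open>The Yang-Baxter equation and the Rota-Baxter identity\<close>

definition rota_baxter_defect :: "'v \<Rightarrow> 'v \<Rightarrow> 'a" where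
  "rota_baxter_defect u v = br (T u) (T v) - T (l (T u) v + \<rho> (T v) u)"

text \<open>
  The transpose \<open>e\<^sup>* \<circ> \<sigma>\<close> of a dual basis vector, as an element of \<open>A \<oplus> V\<^sup>*\<close>.
\<close>

definition \<kappa> :: "('v \<Rightarrow> 'v) \<Rightarrow> 'v \<Rightarrow> 'a \<times> ('v \<Rightarrow> 'k)" where
  "\<kappa> \<sigma> e = (0, \<lambda>v. V.coord e (\<sigma> v))"

lemma \<kappa>_in: "Vector_Spaces.linear scaleV scaleV \<sigma> \<Longrightarrow> \<kappa> \<sigma> e \<in> B"
  by (simp add: \<kappa>_def dual_space_compose[OF V.coord_in_dual_space])

lemma Pair_in [simp]: "(a, 0) \<in> B"
  by (simp add: zero_dual)

lemma zero_actions: "l 0 v = 0" "\<rho> 0 v = 0" "br 0 a = 0" "br a 0 = 0"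
  using l_add[of 0 0 v] \<rho>_add[of 0 0 v] algebra.add_left[of 0 0 a] algebra.add_right[of a 0 0]
  by simp_all

lemma bracket_\<iota>_\<iota>: "brB (\<iota> e) (\<iota> d) = 0"
  by (simp add: \<iota>_def brB_Pair zero_actions dual_spaceD[OF V.coord_in_dual_space] zero_prod_def
      fun_eq_iff)

lemma bracket_\<theta>_\<theta>: "brB (\<theta> u) (\<theta> v) = (br (T u) (T v), 0)"
  by (simp add: \<theta>_def brB_Pair fun_eq_iff)

lemma bracket_\<theta>_\<iota>: "brB (\<theta> u) (\<iota> e) = - \<kappa> (l (T u)) e"
  by (simp add: \<theta>_def \<iota>_def \<kappa>_def brB_Pair fun_eq_iff zero_actions prod_eq_iff)

lemma bracket_\<iota>_\<theta>: "brB (\<iota> e) (\<theta> u) = \<kappa> (\<rho> (T u)) e - \<kappa> (l (T u)) e"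
  by (simp add: \<theta>_def \<iota>_def \<kappa>_def brB_Pair fun_eq_iff zero_actions prod_eq_iff)

text \<open>
  The four combinations of \<open>e\<^sup>* \<otimes> T e\<close> and \<open>-T e \<otimes> e\<^sup>*\<close> in the two copies of \<open>r\<close>
  contribute brackets of two vectors of \<open>A\<close>, which stay as they are, and brackets of a vector with a
  functional, which are transposes \<open>e\<^sup>* \<circ> \<ell>(T d)\<close> or \<open>e\<^sup>* \<circ> \<rho>(T d)\<close>. Moving the
  transposes to the factor of \<open>A\<close> makes all terms comparable, and they add up to the defect of the
  Rota-Baxter identity in each of the three components.
\<close>

lemma tensor_eval_yang_baxter:
  assumes \<Phi>: "trilinear_form_on scaleB B \<Phi>"
  shows "tensor_eval (yang_baxter_tensor brB r) (\<lambda>(x, y, z). \<Phi> x y z) =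
    (\<Sum>e\<in>Basis. \<Sum>d\<in>Basis.
      \<Phi> (rota_baxter_defect e d, 0) (\<iota> e) (\<iota> d)
      + \<Phi> (\<iota> e) (rota_baxter_defect e d - rota_baxter_defect d e, 0) (\<iota> d)
      - \<Phi> (\<iota> e) (\<iota> d) (rota_baxter_defect d e, 0))"
proof -
  note \<Phi>1 = trilinear_form_onD(1)[OF \<Phi>] and \<Phi>2 = trilinear_form_onD(2)[OF \<Phi>]
    and \<Phi>3 = trilinear_form_onD(3)[OF \<Phi>]
  define H where "H a b a' b' =
    \<Phi> (brB a a') b b' + \<Phi> a (brB a' b - brB b a') b' - \<Phi> a a' (brB b' b)" for a b a' b'
  have inner: "bilinear_form_on scaleB B (H a b)" if "a \<in> B" "b \<in> B" for a b
    unfolding H_def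
    by (intro bilinear_form_on_add bilinear_form_on_compose[OF \<Phi>2[OF that(2)]]
        bilinear_form_on_compose[OF \<Phi>3[OF that(1)]] B.linear_intros that)
  have outer: "bilinear_form_on scaleB B (\<lambda>a b. H a b a' b')" if "a' \<in> B" "b' \<in> B" for a' b'
    unfolding H_def
    by (intro bilinear_form_on_add bilinear_form_on_compose[OF \<Phi>1[OF that(2)]]
        bilinear_form_on_compose[OF \<Phi>2[OF that(1)]] B.linear_intros that)
  have "tensor_eval (yang_baxter_tensor brB r) (\<lambda>(x, y, z). \<Phi> x y z) =
      r.contract (\<lambda>a b. r.contract (H a b))"
    by (simp add: yang_baxter_tensor_def r.contract_def H_def case_prod_unfold)
  also have "\<dots> = (\<Sum>e\<in>Basis. r.contract (H (\<iota> e) (\<theta> e)) - r.contract (H (\<theta> e) (\<iota> e)))"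
    by (rule contract_r) (rule r.bilinear_form_on_contract, rule outer)
  also have "\<dots> = (\<Sum>e\<in>Basis. \<Sum>d\<in>Basis.
      (H (\<iota> e) (\<theta> e) (\<iota> d) (\<theta> d) - H (\<iota> e) (\<theta> e) (\<theta> d) (\<iota> d))
      - (H (\<theta> e) (\<iota> e) (\<iota> d) (\<theta> d) - H (\<theta> e) (\<iota> e) (\<theta> d) (\<iota> d)))"
    by (simp add: contract_r inner sum_subtractf)
  also have "\<dots> = (\<Sum>e\<in>Basis. \<Sum>d\<in>Basis.
      \<Phi> (br (T e) (T d), 0) (\<iota> e) (\<iota> d)
      + \<Phi> (\<iota> e) (br (T e) (T d) - br (T d) (T e), 0) (\<iota> d)
      - \<Phi> (\<iota> e) (\<iota> d) (br (T d) (T e), 0)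
      + (\<Phi> (\<iota> e) (\<kappa> (\<rho> (T e)) d) (\<theta> d) + \<Phi> (\<kappa> (l (T d)) e) (\<theta> e) (\<iota> d)
      - \<Phi> (\<kappa> (\<rho> (T d)) e) (\<theta> e) (\<iota> d) - \<Phi> (\<iota> e) (\<theta> d) (\<kappa> (l (T e)) d)
      + \<Phi> (\<iota> e) (\<theta> d) (\<kappa> (\<rho> (T e)) d) + \<Phi> (\<kappa> (l (T e)) d) (\<iota> e) (\<theta> d)
      - \<Phi> (\<theta> e) (\<iota> d) (\<kappa> (l (T d)) e) - \<Phi> (\<theta> e) (\<kappa> (\<rho> (T d)) e) (\<iota> d)))"
  proof (intro sum.cong refl)
    fix e d
    have \<Phi>1_minus: "\<Phi> (x - y) z w = \<Phi> x z w - \<Phi> y z w"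
      and \<Phi>2_minus: "\<Phi> z (x - y) w = \<Phi> z x w - \<Phi> z y w"
      and \<Phi>3_minus: "\<Phi> z w (x - y) = \<Phi> z w x - \<Phi> z w y"
      if "x \<in> B" "y \<in> B" "z \<in> B" "w \<in> B" for x y z w
      by (rule B.bilinear_form_on_minus(1)[OF B.subspace \<Phi>1[OF that(4)] that(1-3)],
          rule B.bilinear_form_on_minus(2)[OF B.subspace \<Phi>1[OF that(4)] that(3,1,2)],
          rule B.bilinear_form_on_minus(2)[OF B.subspace \<Phi>3[OF that(3)] that(4,1,2)])
    have zero: "\<Phi> 0 z w = 0" "\<Phi> z 0 w = 0" "\<Phi> z w 0 = 0" if "z \<in> B" "w \<in> B" for z w
      using \<Phi>1_minus[of 0 0 z w] \<Phi>2_minus[of 0 0 z w] \<Phi>3_minus[of 0 0 z w] that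
        B.subspace_0[OF B.subspace] by auto
    have minus: "\<Phi> (- x) z w = - \<Phi> x z w" "\<Phi> z (- x) w = - \<Phi> z x w" "\<Phi> z w (- x) = - \<Phi> z w x"
      if "x \<in> B" "z \<in> B" "w \<in> B" for x z w
      using \<Phi>1_minus[of 0 x z w] \<Phi>2_minus[of 0 x z w] \<Phi>3_minus[of 0 x z w] zero that
        B.subspace_0[OF B.subspace] by auto
    have in_B: "\<kappa> (l a) e \<in> B" "\<kappa> (\<rho> a) e \<in> B" "0 \<in> B" for a e
      using B.subspace_0[OF B.subspace] by (auto simp: \<kappa>_in linear_l linear_\<rho>)
    have diff_Pair: "(a, 0) - (b, 0) = (a - b, 0 :: 'v \<Rightarrow> 'k)" for a b :: 'a
      by (simp add: prod_eq_iff)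
    have middle: "\<Phi> (\<iota> e) (a - b, 0) (\<iota> d) = \<Phi> (\<iota> e) (a, 0) (\<iota> d) - \<Phi> (\<iota> e) (b, 0) (\<iota> d)"
      for a b
      using \<Phi>2_minus[of "(a, 0)" "(b, 0)" "\<iota> e" "\<iota> d"]
      by (simp only: diff_Pair Pair_in \<iota>_in)
    note simps = H_def bracket_\<iota>_\<iota> bracket_\<theta>_\<theta> bracket_\<theta>_\<iota> bracket_\<iota>_\<theta> diff_Pair
      \<Phi>1_minus \<Phi>2_minus \<Phi>3_minus minus zero in_B B.subspace_neg[OF B.subspace] B.subspace_diff[OF B.subspace]
    have "H (\<iota> e) (\<theta> e) (\<iota> d) (\<theta> d) = \<Phi> (\<iota> e) (\<kappa> (\<rho> (T e)) d) (\<theta> d) - \<Phi> (\<iota> e) (\<iota> d) (br (T d) (T e), 0)"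
      by (simp add: simps)
    moreover have "H (\<iota> e) (\<theta> e) (\<theta> d) (\<iota> d) =
        \<Phi> (\<kappa> (\<rho> (T d)) e) (\<theta> e) (\<iota> d) - \<Phi> (\<kappa> (l (T d)) e) (\<theta> e) (\<iota> d)
        + \<Phi> (\<iota> e) (br (T d) (T e) - br (T e) (T d), 0) (\<iota> d)
        - (\<Phi> (\<iota> e) (\<theta> d) (\<kappa> (\<rho> (T e)) d) - \<Phi> (\<iota> e) (\<theta> d) (\<kappa> (l (T e)) d))"
      by (simp add: simps)
    moreover have "H (\<theta> e) (\<iota> e) (\<iota> d) (\<theta> d) =
        - \<Phi> (\<kappa> (l (T e)) d) (\<iota> e) (\<theta> d) + \<Phi> (\<theta> e) (\<iota> d) (\<kappa> (l (T d)) e)"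
      by (simp add: simps)
    moreover have "H (\<theta> e) (\<iota> e) (\<theta> d) (\<iota> d) =
        \<Phi> (br (T e) (T d), 0) (\<iota> e) (\<iota> d) - \<Phi> (\<theta> e) (\<kappa> (\<rho> (T d)) e) (\<iota> d)"
      by (simp add: simps)
    moreover have "\<Phi> (\<iota> e) (br (T d) (T e) - br (T e) (T d), 0) (\<iota> d) =
        - \<Phi> (\<iota> e) (br (T e) (T d) - br (T d) (T e), 0) (\<iota> d)"
      by (simp only: middle minus_diff_eq)
    ultimately show "(H (\<iota> e) (\<theta> e) (\<iota> d) (\<theta> d) - H (\<iota> e) (\<theta> e) (\<theta> d) (\<iota> d))
      - (H (\<theta> e) (\<iota> e) (\<iota> d) (\<theta> d) - H (\<theta> e) (\<iota> e) (\<theta> d) (\<iota> d)) =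
      \<Phi> (br (T e) (T d), 0) (\<iota> e) (\<iota> d)
      + \<Phi> (\<iota> e) (br (T e) (T d) - br (T d) (T e), 0) (\<iota> d)
      - \<Phi> (\<iota> e) (\<iota> d) (br (T d) (T e), 0)
      + (\<Phi> (\<iota> e) (\<kappa> (\<rho> (T e)) d) (\<theta> d) + \<Phi> (\<kappa> (l (T d)) e) (\<theta> e) (\<iota> d)
      - \<Phi> (\<kappa> (\<rho> (T d)) e) (\<theta> e) (\<iota> d) - \<Phi> (\<iota> e) (\<theta> d) (\<kappa> (l (T e)) d)
      + \<Phi> (\<iota> e) (\<theta> d) (\<kappa> (\<rho> (T e)) d) + \<Phi> (\<kappa> (l (T e)) d) (\<iota> e) (\<theta> d)
      - \<Phi> (\<theta> e) (\<iota> d) (\<kappa> (l (T d)) e) - \<Phi> (\<theta> e) (\<kappa> (\<rho> (T d)) e) (\<iota> d))"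
      by simp
  qed
  also have "\<dots> = (\<Sum>e\<in>Basis. \<Sum>d\<in>Basis.
      \<Phi> (br (T e) (T d), 0) (\<iota> e) (\<iota> d)
      + \<Phi> (\<iota> e) (br (T e) (T d) - br (T d) (T e), 0) (\<iota> d)
      - \<Phi> (\<iota> e) (\<iota> d) (br (T d) (T e), 0)
      + (\<Phi> (\<iota> e) (\<iota> d) (\<theta> (\<rho> (T e) d)) + \<Phi> (\<iota> e) (\<theta> (l (T d) e)) (\<iota> d)
      - \<Phi> (\<iota> e) (\<theta> (\<rho> (T d) e)) (\<iota> d) - \<Phi> (\<iota> e) (\<theta> (l (T e) d)) (\<iota> d)
      + \<Phi> (\<iota> e) (\<theta> (\<rho> (T e) d)) (\<iota> d) + \<Phi> (\<iota> e) (\<iota> d) (\<theta> (l (T d) e))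
      - \<Phi> (\<theta> (l (T e) d)) (\<iota> e) (\<iota> d) - \<Phi> (\<theta> (\<rho> (T d) e)) (\<iota> e) (\<iota> d)))"
  proof -
    note flip = bilinear_form_on_compose_flip[OF _ linear_on_id linear_on_id]
    have 1: "(\<Sum>d\<in>Basis. \<Phi> (\<iota> e) (\<kappa> (\<rho> a) d) (\<theta> d)) = (\<Sum>d\<in>Basis. \<Phi> (\<iota> e) (\<iota> d) (\<theta> (\<rho> a d)))"
      for e a
      unfolding \<kappa>_def by (rule transpose_contraction[OF \<Phi>3 linear_\<rho>]) simp
    have 2: "(\<Sum>e\<in>Basis. \<Phi> (\<kappa> \<sigma> e) (\<theta> e) (\<iota> d)) = (\<Sum>e\<in>Basis. \<Phi> (\<iota> e) (\<theta> (\<sigma> e)) (\<iota> d))"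
      if "Vector_Spaces.linear scaleV scaleV \<sigma>" for \<sigma> d
      unfolding \<kappa>_def by (rule transpose_contraction[OF \<Phi>1 that]) simp
    have 3: "(\<Sum>d\<in>Basis. \<Phi> (\<iota> e) (\<theta> d) (\<kappa> \<sigma> d)) = (\<Sum>d\<in>Basis. \<Phi> (\<iota> e) (\<theta> (\<sigma> d)) (\<iota> d))"
      if "Vector_Spaces.linear scaleV scaleV \<sigma>" for \<sigma> e
      unfolding \<kappa>_def by (rule transpose_contraction[OF flip[OF \<Phi>3] that]) simp
    have 4: "(\<Sum>d\<in>Basis. \<Phi> (\<kappa> (l a) d) (\<iota> e) (\<theta> d)) = (\<Sum>d\<in>Basis. \<Phi> (\<iota> d) (\<iota> e) (\<theta> (l a d)))"
      for e a
      unfolding \<kappa>_def by (rule transpose_contraction[OF \<Phi>2 linear_l]) simp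
    have 5: "(\<Sum>e\<in>Basis. \<Phi> (\<theta> e) (\<iota> d) (\<kappa> (l a) e)) = (\<Sum>e\<in>Basis. \<Phi> (\<theta> (l a e)) (\<iota> d) (\<iota> e))"
      for d a
      unfolding \<kappa>_def by (rule transpose_contraction[OF flip[OF \<Phi>2] linear_l]) simp
    have 6: "(\<Sum>e\<in>Basis. \<Phi> (\<theta> e) (\<kappa> (\<rho> a) e) (\<iota> d)) = (\<Sum>e\<in>Basis. \<Phi> (\<theta> (\<rho> a e)) (\<iota> e) (\<iota> d))"
      for d a
      unfolding \<kappa>_def by (rule transpose_contraction[OF flip[OF \<Phi>1] linear_\<rho>]) simp
    have swap: "(\<Sum>e\<in>Basis. \<Sum>d\<in>Basis. G e d) = (\<Sum>d\<in>Basis. \<Sum>e\<in>Basis. G e d)"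
      for G :: "'v \<Rightarrow> 'v \<Rightarrow> 'k"
      by (rule sum.swap)
    have s2: "(\<Sum>e\<in>Basis. \<Sum>d\<in>Basis. \<Phi> (\<kappa> (\<sigma> d) e) (\<theta> e) (\<iota> d)) =
        (\<Sum>e\<in>Basis. \<Sum>d\<in>Basis. \<Phi> (\<iota> e) (\<theta> (\<sigma> d e)) (\<iota> d))"
      if "\<And>d. Vector_Spaces.linear scaleV scaleV (\<sigma> d)" for \<sigma>
      unfolding swap[of "\<lambda>e d. \<Phi> (\<kappa> (\<sigma> d) e) (\<theta> e) (\<iota> d)"]
        swap[of "\<lambda>e d. \<Phi> (\<iota> e) (\<theta> (\<sigma> d e)) (\<iota> d)"]
      by (simp only: 2[OF that])
    have s4: "(\<Sum>e\<in>Basis. \<Sum>d\<in>Basis. \<Phi> (\<kappa> (l (T e)) d) (\<iota> e) (\<theta> d)) =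
        (\<Sum>e\<in>Basis. \<Sum>d\<in>Basis. \<Phi> (\<iota> e) (\<iota> d) (\<theta> (l (T d) e)))"
      unfolding swap[of "\<lambda>e d. \<Phi> (\<iota> e) (\<iota> d) (\<theta> (l (T d) e))"] by (simp only: 4)
    have s5: "(\<Sum>e\<in>Basis. \<Sum>d\<in>Basis. \<Phi> (\<theta> e) (\<iota> d) (\<kappa> (l (T d)) e)) =
        (\<Sum>e\<in>Basis. \<Sum>d\<in>Basis. \<Phi> (\<theta> (l (T e) d)) (\<iota> e) (\<iota> d))"
      unfolding swap[of "\<lambda>e d. \<Phi> (\<theta> e) (\<iota> d) (\<kappa> (l (T d)) e)"] by (simp only: 5)
    have s6: "(\<Sum>e\<in>Basis. \<Sum>d\<in>Basis. \<Phi> (\<theta> e) (\<kappa> (\<rho> (T d)) e) (\<iota> d)) =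
        (\<Sum>e\<in>Basis. \<Sum>d\<in>Basis. \<Phi> (\<theta> (\<rho> (T d) e)) (\<iota> e) (\<iota> d))"
      unfolding swap[of "\<lambda>e d. \<Phi> (\<theta> e) (\<kappa> (\<rho> (T d)) e) (\<iota> d)"]
        swap[of "\<lambda>e d. \<Phi> (\<theta> (\<rho> (T d) e)) (\<iota> e) (\<iota> d)"] by (simp only: 6)
    show ?thesis
      unfolding sum.distrib sum_subtractf 1 3[OF linear_l] 3[OF linear_\<rho>]
        s2[of "\<lambda>d. l (T d)", OF linear_l] s2[of "\<lambda>d. \<rho> (T d)", OF linear_\<rho>] s4 s5 s6
      by (rule refl)
  qed
  also have "\<dots> = (\<Sum>e\<in>Basis. \<Sum>d\<in>Basis.
      \<Phi> (rota_baxter_defect e d, 0) (\<iota> e) (\<iota> d)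
      + \<Phi> (\<iota> e) (rota_baxter_defect e d - rota_baxter_defect d e, 0) (\<iota> d)
      - \<Phi> (\<iota> e) (\<iota> d) (rota_baxter_defect d e, 0))"
  proof (intro sum.cong refl)
    fix e d
    have form: "g (rota_baxter_defect u v, 0) =
        g (br (T u) (T v), 0) - g (\<theta> (l (T u) v)) - g (\<theta> (\<rho> (T v) u))"
      and form_diff: "g (a - b, 0) = g (a, 0) - g (b, 0)"
      if g: "linear_form_on scaleB B g" for g u v a b
    proof -
      have g_diff: "g (a - b, 0) = g (a, 0) - g (b, 0)" for a b
        using B.linear_form_on_minus[OF B.subspace g, of "(a, 0)" "(b, 0)"]
        by (simp add: minus_prod_def zero_dual)
      then show "g (a - b, 0) = g (a, 0) - g (b, 0)" .
      have "rota_baxter_defect u v = (br (T u) (T v) - T (l (T u) v)) - T (\<rho> (T v) u)"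
        by (simp add: rota_baxter_defect_def linearD[OF linear_T])
      then show "g (rota_baxter_defect u v, 0) =
        g (br (T u) (T v), 0) - g (\<theta> (l (T u) v)) - g (\<theta> (\<rho> (T v) u))"
        by (simp only: g_diff \<theta>_def)
    qed
    have "linear_form_on scaleB B (\<lambda>x. \<Phi> x y z)" "linear_form_on scaleB B (\<lambda>x. \<Phi> y x z)"
      "linear_form_on scaleB B (\<Phi> y z)" if "y \<in> B" "z \<in> B" for y z
      using \<Phi> that by (auto simp: trilinear_form_on_def)
    note forms = this[OF \<iota>_in[of e] \<iota>_in[of d]]
    show "\<Phi> (br (T e) (T d), 0) (\<iota> e) (\<iota> d)
      + \<Phi> (\<iota> e) (br (T e) (T d) - br (T d) (T e), 0) (\<iota> d)
      - \<Phi> (\<iota> e) (\<iota> d) (br (T d) (T e), 0)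
      + (\<Phi> (\<iota> e) (\<iota> d) (\<theta> (\<rho> (T e) d)) + \<Phi> (\<iota> e) (\<theta> (l (T d) e)) (\<iota> d)
      - \<Phi> (\<iota> e) (\<theta> (\<rho> (T d) e)) (\<iota> d) - \<Phi> (\<iota> e) (\<theta> (l (T e) d)) (\<iota> d)
      + \<Phi> (\<iota> e) (\<theta> (\<rho> (T e) d)) (\<iota> d) + \<Phi> (\<iota> e) (\<iota> d) (\<theta> (l (T d) e))
      - \<Phi> (\<theta> (l (T e) d)) (\<iota> e) (\<iota> d) - \<Phi> (\<theta> (\<rho> (T d) e)) (\<iota> e) (\<iota> d)) =
      \<Phi> (rota_baxter_defect e d, 0) (\<iota> e) (\<iota> d)
      + \<Phi> (\<iota> e) (rota_baxter_defect e d - rota_baxter_defect d e, 0) (\<iota> d)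
      - \<Phi> (\<iota> e) (\<iota> d) (rota_baxter_defect d e, 0)"
      using form[OF forms(1), of e d] form[OF forms(2), of e d] form[OF forms(2), of d e]
        form[OF forms(3), of d e]
        form_diff[OF forms(2), of "br (T e) (T d)" "br (T d) (T e)"]
        form_diff[OF forms(2), of "rota_baxter_defect e d" "rota_baxter_defect d e"]
      by simp
  qed
  finally show ?thesis .
qed

lemma rota_baxter_defect_linear:
  shows "Vector_Spaces.linear scaleV scaleA (\<lambda>u. rota_baxter_defect u v)"
    and "Vector_Spaces.linear scaleV scaleA (rota_baxter_defect u)"
  unfolding Vector_Spaces.linear_iff rota_baxter_defect_def
  using algebra.vector_space_axioms module.vector_space_axioms
  by (simp_all add: linearD[OF linear_T] linearD[OF linear_l] linearD[OF linear_\<rho>] l_add l_scale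
      \<rho>_add \<rho>_scale algebra.add_left algebra.add_right algebra.scale_left algebra.scale_right
      algebra.scale_right_diff_distrib algebra.scale_right_distrib algebra_simps)

lemma dual_form_expansion:
  assumes "Vector_Spaces.linear scaleV scaleA R" "g \<in> dual_space scaleA"
  shows "(\<Sum>e\<in>Basis. V.coord e u * g (R e)) = g (R u)"
proof -
  have "Vector_Spaces.linear scaleV (*) (g \<circ> R)"
    using assms by (auto simp: dual_space_def intro: Vector_Spaces.linear_compose)
  from V.linear_expansion[OF this, of u] show ?thesis by simp
qed

text \<open>
  For the forward direction the form \<open>g(x\<^sub>A) y\<^sub>V(u) z\<^sub>V(v)\<close>, built from the components of its
  arguments in \<open>A\<close> and \<open>V\<^sup>*\<close>, sees only the component in \<open>A \<otimes> V\<^sup>* \<otimes> V\<^sup>*\<close>, whose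
  value is \<open>g(R(u, v))\<close>.
\<close>

lemma yang_baxter_iff:
  "eq_tensor3 scaleB B (yang_baxter_tensor brB r) 0 \<longleftrightarrow> (\<forall>u v. rota_baxter_defect u v = 0)"
proof
  assume "\<forall>u v. rota_baxter_defect u v = 0"
  then have defect: "rota_baxter_defect u v = 0" for u v by simp
  show "eq_tensor3 scaleB B (yang_baxter_tensor brB r) 0"
    unfolding eq_tensor3_iff
  proof (intro allI impI)
    fix \<Phi> assume \<Phi>: "trilinear_form_on scaleB B \<Phi>"
    have "\<Phi> (0, 0) (\<iota> e) (\<iota> d) = 0" "\<Phi> (\<iota> e) (0, 0) (\<iota> d) = 0" "\<Phi> (\<iota> e) (\<iota> d) (0, 0) = 0" for e d
      using bilinear_form_onD(1)[OF trilinear_form_onD(1)[OF \<Phi> \<iota>_in[of d]], of "(0, 0)" "(0, 0)" "\<iota> e"]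
        bilinear_form_onD(2)[OF trilinear_form_onD(1)[OF \<Phi> \<iota>_in[of d]], of "\<iota> e" "(0, 0)" "(0, 0)"]
        bilinear_form_onD(2)[OF trilinear_form_onD(3)[OF \<Phi> \<iota>_in[of e]], of "\<iota> d" "(0, 0)" "(0, 0)"]
      by (simp_all add: zero_dual)
    then show "tensor_eval (yang_baxter_tensor brB r) (\<lambda>(x, y, z). \<Phi> x y z) =
        tensor_eval 0 (\<lambda>(x, y, z). \<Phi> x y z)"
      by (simp add: tensor_eval_yang_baxter[OF \<Phi>] defect)
  qed
next
  assume yb: "eq_tensor3 scaleB B (yang_baxter_tensor brB r) 0"
  show "\<forall>u v. rota_baxter_defect u v = 0"
  proof (intro allI algebra.dual_separates_points)
    fix u v g assume g: "g \<in> dual_space scaleA"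
    define \<Phi> where "\<Phi> x y z = g (fst x) * snd y u * snd z v"
      for x y z :: "'a \<times> ('v \<Rightarrow> 'k)"
    have "trilinear_form_on scaleB B \<Phi>"
      unfolding trilinear_form_on_def linear_form_on_def \<Phi>_def
      by (auto simp: scaleB_Pair dual_spaceD[OF g] algebra_simps)
    then have "(\<Sum>e\<in>Basis. \<Sum>d\<in>Basis.
      \<Phi> (rota_baxter_defect e d, 0) (\<iota> e) (\<iota> d)
      + \<Phi> (\<iota> e) (rota_baxter_defect e d - rota_baxter_defect d e, 0) (\<iota> d)
      - \<Phi> (\<iota> e) (\<iota> d) (rota_baxter_defect d e, 0)) = 0"
      using yb tensor_eval_yang_baxter unfolding eq_tensor3_iff by simp
    then have "(\<Sum>e\<in>Basis. \<Sum>d\<in>Basis. V.coord e u * (V.coord d v * g (rota_baxter_defect e d))) = 0"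
      by (simp add: \<Phi>_def \<iota>_def dual_spaceD[OF g] mult_ac)
    then show "g (rota_baxter_defect u v) = 0"
      by (simp add: sum_distrib_left[symmetric] dual_form_expansion[OF rota_baxter_defect_linear(2) g]
          dual_form_expansion[OF rota_baxter_defect_linear(1) g])
  qed
qed

text \<open>
  The tensor \<open>(P \<otimes> id - id \<otimes> M) r\<close> has components in \<open>V\<^sup>* \<otimes> A\<close> and in \<open>A \<otimes> V\<^sup>*\<close>,
  given by \<open>T \<alpha> - N T\<close> and \<open>T \<beta> - S T\<close>. The forms \<open>x\<^sub>V(u) g(y\<^sub>A)\<close> and
  \<open>g(x\<^sub>A) y\<^sub>V(u)\<close> read them off separately.
\<close>

lemma invariance_iff:
  assumes N: "Vector_Spaces.linear scaleA scaleA N" and S: "Vector_Spaces.linear scaleA scaleA S"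
    and \<alpha>: "Vector_Spaces.linear scaleV scaleV \<alpha>" and \<beta>: "Vector_Spaces.linear scaleV scaleV \<beta>"
  defines "M \<equiv> map_prod N (dual_map \<beta>)" and "P \<equiv> map_prod S (dual_map \<alpha>)"
  shows "eq_tensor2 scaleB B (map_tensor P id r - map_tensor id M r) 0 \<longleftrightarrow>
    (\<forall>u. N (T u) = T (\<alpha> u)) \<and> (\<forall>u. T (\<beta> u) = S (T u))"
proof -
  have eval: "tensor_eval (map_tensor P id r - map_tensor id M r) (\<lambda>(x, y). F x y) =
      (\<Sum>e\<in>Basis. F (\<iota> e) (T (\<alpha> e) - N (T e), 0) + F (T (\<beta> e) - S (T e), 0) (\<iota> e))"
    if F: "bilinear_form_on scaleB B F" for F
  proof -
    have P: "linear_on scaleB B P" and M: "linear_on scaleB B M"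
      unfolding P_def M_def by (intro linear_on_map_prod_dual N S \<alpha> \<beta>)+
    have P_\<iota>: "P (\<iota> e) = (0, \<lambda>v. V.coord e (\<alpha> v))" and P_\<theta>: "P (\<theta> e) = (S (T e), 0)"
      and M_\<iota>: "M (\<iota> e) = (0, \<lambda>v. V.coord e (\<beta> v))" and M_\<theta>: "M (\<theta> e) = (N (T e), 0)" for e
      using linearD(5)[OF N] linearD(5)[OF S]
      by (simp_all add: P_def M_def \<iota>_def \<theta>_def dual_map_def o_def fun_eq_iff)
    have "tensor_eval (map_tensor P id r - map_tensor id M r) (\<lambda>(x, y). F x y) =
        r.contract (\<lambda>x y. F (P x) y) - r.contract (\<lambda>x y. F x (M y))"
      by (simp add: r.contract_def case_prod_unfold)
    also have "\<dots> = (\<Sum>e\<in>Basis. F (P (\<iota> e)) (\<theta> e) - F (P (\<theta> e)) (\<iota> e))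
        - (\<Sum>e\<in>Basis. F (\<iota> e) (M (\<theta> e)) - F (\<theta> e) (M (\<iota> e)))"
      by (simp only: contract_r bilinear_form_on_compose[OF F P linear_on_id]
          bilinear_form_on_compose[OF F linear_on_id M])
    also have "\<dots> = (\<Sum>e\<in>Basis. F (\<iota> e) (\<theta> (\<alpha> e))) - (\<Sum>e\<in>Basis. F (S (T e), 0) (\<iota> e))
        - (\<Sum>e\<in>Basis. F (\<iota> e) (N (T e), 0)) + (\<Sum>e\<in>Basis. F (\<theta> (\<beta> e)) (\<iota> e))"
      using transpose_contraction[OF F \<alpha>]
        transpose_contraction[OF bilinear_form_on_compose_flip[OF F linear_on_id linear_on_id] \<beta>]
      by (simp add: P_\<iota> P_\<theta> M_\<iota> M_\<theta> sum_subtractf)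
    also have "\<dots> = (\<Sum>e\<in>Basis. (F (\<iota> e) (\<theta> (\<alpha> e)) - F (\<iota> e) (N (T e), 0))
        + (F (\<theta> (\<beta> e)) (\<iota> e) - F (S (T e), 0) (\<iota> e)))"
      by (simp add: sum.distrib sum_subtractf)
    also have "\<dots> = (\<Sum>e\<in>Basis. F (\<iota> e) (T (\<alpha> e) - N (T e), 0) + F (T (\<beta> e) - S (T e), 0) (\<iota> e))"
    proof (intro sum.cong refl)
      fix e
      show "(F (\<iota> e) (\<theta> (\<alpha> e)) - F (\<iota> e) (N (T e), 0)) + (F (\<theta> (\<beta> e)) (\<iota> e) - F (S (T e), 0) (\<iota> e)) =
          F (\<iota> e) (T (\<alpha> e) - N (T e), 0) + F (T (\<beta> e) - S (T e), 0) (\<iota> e)"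
        using B.bilinear_form_on_minus(2)[OF B.subspace F, of "\<iota> e" "(T (\<alpha> e), 0)" "(N (T e), 0)"]
          B.bilinear_form_on_minus(1)[OF B.subspace F, of "(T (\<beta> e), 0)" "(S (T e), 0)" "\<iota> e"]
        by (simp add: \<theta>_def minus_prod_def zero_dual)
    qed
    finally show ?thesis .
  qed
  have linear: "Vector_Spaces.linear scaleV scaleA (\<lambda>e. T (\<alpha> e) - N (T e))"
    "Vector_Spaces.linear scaleV scaleA (\<lambda>e. T (\<beta> e) - S (T e))"
    unfolding Vector_Spaces.linear_iff
    using algebra.vector_space_axioms module.vector_space_axioms
    by (simp_all add: linearD[OF linear_T] linearD[OF N] linearD[OF S] linearD[OF \<alpha>] linearD[OF \<beta>]
        algebra.scale_right_diff_distrib algebra_simps)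
  show ?thesis
  proof
    assume "(\<forall>u. N (T u) = T (\<alpha> u)) \<and> (\<forall>u. T (\<beta> u) = S (T u))"
    then have eqs: "N (T u) = T (\<alpha> u)" "T (\<beta> u) = S (T u)" for u by auto
    show "eq_tensor2 scaleB B (map_tensor P id r - map_tensor id M r) 0"
      unfolding eq_tensor2_iff
    proof (intro allI impI)
      fix F assume F: "bilinear_form_on scaleB B F"
      have "F (\<iota> e) (0, 0) = 0" "F (0, 0) (\<iota> e) = 0" for e
        using bilinear_form_onD(1)[OF F, of "(0, 0)" "(0, 0)" "\<iota> e"]
          bilinear_form_onD(2)[OF F, of "\<iota> e" "(0, 0)" "(0, 0)"]
        by (simp_all add: zero_dual)
      then show "tensor_eval (map_tensor P id r - map_tensor id M r) (\<lambda>(x, y). F x y) =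
          tensor_eval 0 (\<lambda>(x, y). F x y)"
        by (simp add: eval[OF F] eqs del: tensor_eval_diff)
    qed
  next
    assume inv: "eq_tensor2 scaleB B (map_tensor P id r - map_tensor id M r) 0"
    have sum0: "(\<Sum>e\<in>Basis. F (\<iota> e) (T (\<alpha> e) - N (T e), 0) + F (T (\<beta> e) - S (T e), 0) (\<iota> e)) = 0"
      if F: "bilinear_form_on scaleB B F" for F
      using inv F unfolding eq_tensor2_iff by (simp add: eval[symmetric] del: tensor_eval_diff)
    have "T (\<alpha> u) - N (T u) = 0" for u
    proof (rule algebra.dual_separates_points)
      fix g assume g: "g \<in> dual_space scaleA"
      have "bilinear_form_on scaleB B (\<lambda>x y. snd x u * g (fst y))"
        unfolding bilinear_form_on_def linear_form_on_def
        by (auto simp: scaleB_Pair dual_spaceD[OF g] algebra_simps)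
      from sum0[OF this] have "(\<Sum>e\<in>Basis. V.coord e u * g (T (\<alpha> e) - N (T e))) = 0"
        by (simp add: \<iota>_def)
      then show "g (T (\<alpha> u) - N (T u)) = 0"
        by (simp only: dual_form_expansion[OF linear(1) g])
    qed
    moreover have "T (\<beta> u) - S (T u) = 0" for u
    proof (rule algebra.dual_separates_points)
      fix g assume g: "g \<in> dual_space scaleA"
      have "bilinear_form_on scaleB B (\<lambda>x y. snd y u * g (fst x))"
        unfolding bilinear_form_on_def linear_form_on_def
        by (auto simp: scaleB_Pair dual_spaceD[OF g] algebra_simps)
      from sum0[OF this] have "(\<Sum>e\<in>Basis. V.coord e u * g (T (\<beta> e) - S (T e))) = 0"
        by (simp add: \<iota>_def)
      then show "g (T (\<beta> u) - S (T u)) = 0"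
        by (simp only: dual_form_expansion[OF linear(2) g])
    qed
    ultimately show "(\<forall>u. N (T u) = T (\<alpha> u)) \<and> (\<forall>u. T (\<beta> u) = S (T u))"
      by simp
  qed
qed

lemma admissible_solution_iff:
  assumes N: "Vector_Spaces.linear scaleA scaleA N" and S: "Vector_Spaces.linear scaleA scaleA S"
    and \<alpha>: "Vector_Spaces.linear scaleV scaleV \<alpha>" and \<beta>: "Vector_Spaces.linear scaleV scaleV \<beta>"
  shows "admissible_yang_baxter_solution scaleB B brB (map_prod N (dual_map \<beta>))
      (map_prod S (dual_map \<alpha>)) r \<longleftrightarrow>
    weak_relative_rota_baxter scaleA br N scaleV l \<rho> \<alpha> T \<and> T \<circ> \<beta> = S \<circ> T"
  using linear_T r_in_B
  unfolding admissible_yang_baxter_solution_def weak_relative_rota_baxter_def yang_baxter_iff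
    invariance_iff[OF assms]
  by (auto simp: rota_baxter_defect_def fun_eq_iff)

end

section \<open>Relative Rota-Baxter operators and the Yang-Baxter equation\<close>

theorem theorem3p19:
  fixes scaleA :: "'k::field_char_0 \<Rightarrow> 'a::ab_group_add \<Rightarrow> 'a"
    and scaleV :: "'k \<Rightarrow> 'v::ab_group_add \<Rightarrow> 'v"
    and br :: "'a \<Rightarrow> 'a \<Rightarrow> 'a" and N S :: "'a \<Rightarrow> 'a"
    and l \<rho> :: "'a \<Rightarrow> 'v \<Rightarrow> 'v" and \<alpha> \<beta> :: "'v \<Rightarrow> 'v" and T :: "'v \<Rightarrow> 'a"
    and Basis :: "'v set"
    and Tsharp :: "(('v \<Rightarrow> 'k) \<times> 'a) \<Rightarrow>\<^sub>0 'k"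
  defines "B \<equiv> (UNIV :: 'a set) \<times> dual_space scaleV"
    and "scaleB \<equiv> dual_sum_scale scaleA"
    and "brB \<equiv> semidirect_bracket br (dual_action l)
                 (\<lambda>x f. dual_action l x f - dual_action \<rho> x f)"
    and "M \<equiv> map_prod N (dual_map \<beta>)"
    and "P \<equiv> map_prod S (dual_map \<alpha>)"
    and "r \<equiv> include_tensor Tsharp - flip_tensor (include_tensor Tsharp)"
  assumes "nijenhuis_left_alia_algebra scaleA UNIV br N"
    and "finite_dimensional_vector_space scaleV Basis"
    and "left_alia_representation scaleA br scaleV l \<rho>"
    and "Vector_Spaces.linear scaleV scaleV \<beta>"
    and "admissible_operator N l \<rho> \<beta>"
    and "Vector_Spaces.linear scaleA scaleA S"
    and "Vector_Spaces.linear scaleV scaleV \<alpha>"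
    and "Vector_Spaces.linear scaleV scaleA T"
    and "represents_map scaleA scaleV T Tsharp"
  shows "nijenhuis_left_alia_algebra scaleB B brB M \<and>
    ((antisymmetric_tensor scaleB B r \<and> admissible_yang_baxter_solution scaleB B brB M P r)
      \<longleftrightarrow> (weak_relative_rota_baxter scaleA br N scaleV l \<rho> \<alpha> T \<and> T \<circ> \<beta> = S \<circ> T)) \<and>
    (nijenhuis_left_alia_representation scaleA br N scaleV l \<rho> \<alpha> \<longrightarrow>
      relative_rota_baxter scaleA br N scaleV l \<rho> \<alpha> T \<and> T \<circ> \<beta> = S \<circ> T \<longrightarrow>
      (antisymmetric_tensor scaleB B r \<and> admissible_yang_baxter_solution scaleB B brB M P r) \<and>
      (adjoint_admissible UNIV br N S \<and>
       (\<forall>x v. \<beta> (\<rho> x (\<alpha> v)) + \<rho> (S (S x)) v = \<rho> (S x) (\<alpha> v) + \<beta> (\<rho> (S x) v)) \<and>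
       (\<forall>x v. \<beta> (l x (\<alpha> v)) + l (S (S x)) v = l (S x) (\<alpha> v) + \<beta> (l (S x) v))
       \<longrightarrow> nijenhuis_left_alia_bialgebra scaleB B brB (coboundary brB r) M P))"
proof -
  interpret N: nijenhuis_left_alia_algebra scaleA UNIV br N by fact
  interpret V: finite_dimensional_vector_space scaleV Basis by fact
  interpret representation: left_alia_representation scaleA br scaleV l \<rho> by fact
  interpret op: operator_tensor scaleA br scaleV l \<rho> Basis T Tsharp
    by (intro operator_tensor.intro dual_semidirect_product.intro operator_tensor_axioms.intro assms)
  have eqs: "B = op.B" "brB = op.brB" "r = op.r"
    by (simp_all add: B_def op.B_def brB_def op.brB_def r_def op.r_def)
  have linear_N: "Vector_Spaces.linear scaleA scaleA N"
    using N.linear_N N.vector_space_axioms by (simp add: linear_on_def Vector_Spaces.linear_iff)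
  note antisymmetric = op.r_antisymmetric
  have nijenhuis: "nijenhuis_left_alia_algebra scaleB op.B op.brB M"
    unfolding scaleB_def M_def by (intro op.nijenhuis_B assms)
  have iff: "admissible_yang_baxter_solution scaleB op.B op.brB M P op.r \<longleftrightarrow>
      weak_relative_rota_baxter scaleA br N scaleV l \<rho> \<alpha> T \<and> T \<circ> \<beta> = S \<circ> T"
    unfolding scaleB_def M_def P_def by (intro op.admissible_solution_iff linear_N assms)
  have bialgebra: "nijenhuis_left_alia_bialgebra scaleB op.B op.brB (coboundary op.brB op.r) M P"
    if solution: "admissible_yang_baxter_solution scaleB op.B op.brB M P op.r"
      and \<alpha>: "nijenhuis_left_alia_representation scaleA br N scaleV l \<rho> \<alpha>"
      and S: "adjoint_admissible UNIV br N S"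
      and \<rho>: "\<forall>x v. \<beta> (\<rho> x (\<alpha> v)) + \<rho> (S (S x)) v = \<rho> (S x) (\<alpha> v) + \<beta> (\<rho> (S x) v)"
      and l: "\<forall>x v. \<beta> (l x (\<alpha> v)) + l (S (S x)) v = l (S x) (\<alpha> v) + \<beta> (l (S x) v)"
  proof -
    have "linear_on scaleB op.B P"
      unfolding scaleB_def P_def by (intro op.linear_on_map_prod_dual assms)
    moreover have "adjoint_admissible op.B op.brB M P"
      unfolding M_def P_def using \<rho> l by (intro op.adjoint_admissible_B S \<alpha>) auto
    ultimately have "nijenhuis_antisymmetric_tensor_algebra scaleB op.B op.brB op.r M P"
      using nijenhuis op.r.antisymmetric_tensor_algebra_axioms solution
      by (simp add: nijenhuis_antisymmetric_tensor_algebra_def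
          nijenhuis_antisymmetric_tensor_algebra_axioms_def admissible_yang_baxter_solution_def
          scaleB_def)
    then show ?thesis
      using solution
      by (intro nijenhuis_antisymmetric_tensor_algebra.nijenhuis_coboundary_bialgebra)
        (simp_all add: admissible_yang_baxter_solution_def)
  qed
  show ?thesis
    unfolding eqs
    using nijenhuis iff antisymmetric bialgebra
    by (auto simp: relative_rota_baxter_def scaleB_def)
qed

end
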